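(* Let $h\in\overline{\mathrm{Conv}}(Z)$ for a nonempty convex set $Z\subseteq\mathcal Z$, let $f\in\mathcal C_{m,M}(Z)$ with $m,M>0$, let $\phi=f+h$, and assume $\phi_*:=\inf_{z\in\mathcal Z}\phi(z)>-\infty$. Let $\hat\rho>0$, $\sigma\in(0,1)$, $\lambda\in(0,1/m)$ and $z_0\in Z$. Then the AIPP method (described in the context) with these inputs stops and outputs a pair $(\hat z,\hat v)\in Z\times\mathcal Z$ satisfying $$\hat v\in\nabla f(\hat z)+\partial h(\hat z),\qquad \|\hat v\|\le\hat\rho,$$ in $$\mathcal O\left(\sqrt{\frac{\lambda M+1}{\min\{\sigma,1-\lambda m\}}}\left[\frac{R_\lambda\phi(z_0)}{(1-\sigma)^2\lambda^2\hat\rho^2}+\log_1^+(\lambda M)\right]\right)$$ inner iterations (i.e. total ACG iterations).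
   Context: $\mathcal Z$ is a finite dimensional inner product space with induced norm $\|\cdot\|$. $\overline{\mathrm{Conv}}(Z)$: proper lower semicontinuous convex functions $\mathcal Z\to(-\infty,\infty]$ that are real-valued exactly on $Z$. $\ell_f(u;z)=f(z)+\langle\nabla f(z),u-z\rangle$. $\mathcal C_{m,M}(Z)$: functions continuously differentiable on $Z$ (finite on an open set containing $Z$) with $-\frac m2\|u-z\|^2\le f(u)-\ell_f(u;z)\le\frac M2\|u-z\|^2$ for all $u,z\in Z$. $\log_1^+(t)=\max\{\log t,1\}$. $\mathcal O(B)$ means at most $C\max\{1,B\}$ for a universal constant $C$. Define $$R_\lambda\phi(z_0)=\inf_{u\in\mathcal Z}\left\{\tfrac12\|z_0-u\|^2+\lambda[\phi(u)-\phi_*]\right\}.$$ ACG iterations with inputs $(\psi_s,\psi_n,y_0,\mu,L)$: set $\psi=\psi_s+\psi_n$, $A_0=0$, $\Gamma_0\equiv0$, $x_0=y_0$, and for $k=1,2,\dots$: $\tau_{k-1}=(1+\mu A_{k-1})/L$, $a_{k-1}=\frac12\left(\tau_{k-1}+\sqrt{\tau_{k-1}^2+4\tau_{k-1}A_{k-1}}\right)$, $A_k=A_{k-1}+a_{k-1}$, $\tilde x_{k-1}=\frac{A_{k-1}}{A_k}y_{k-1}+\frac{a_{k-1}}{A_k}x_{k-1}$, $q_k=\ell_{\psi_s}(\cdot;\tilde x_{k-1})+\psi_n+\frac\mu2\|\cdot-\tilde x_{k-1}\|^2$, $y_k=\operatorname{argmin}_y\{\frac1Lq_k(y)+\frac12\|y-\tilde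 x_{k-1}\|^2\}$, $x_k=x_{k-1}+\frac{a_{k-1}}{1+\mu A_k}[L(y_k-\tilde x_{k-1})+\mu(y_k-x_{k-1})]$, $\gamma_{k-1}=q_k(y_k)+L\langle\tilde x_{k-1}-y_k,\cdot-y_k\rangle+\frac\mu2\|\cdot-y_k\|^2$, $\Gamma_k=\frac{A_{k-1}}{A_k}\Gamma_{k-1}+\frac{a_{k-1}}{A_k}\gamma_{k-1}$, $r_k=(x_0-x_k)/A_k$, $\eta_k=\psi(y_k)-\Gamma_k(x_k)-\langle r_k,y_k-x_k\rangle$. ACG1 runs these iterations and returns $(y_k,r_k,\eta_k)$ at the first $k$ with $\|r_k\|^2+2\eta_k\le\sigma\|y_0-y_k+r_k\|^2$ and $A_k\ge\max\{8,9/\mu\}$. ACG2, with extra input $\bar\eta$, returns $(y_k,r_k,\eta_k)$ at the first $k$ with $\|r_k\|^2+2\eta_k\le\sigma\|y_0-y_k+r_k\|^2$ and $\eta_k\le\bar\eta$. AIPP method: set $\mu=1-\lambda m$, $L=1+\lambda M$, $\bar\rho=\hat\rho/4$, $\bar\varepsilon=\hat\rho^2/(32[\max\{m,M\}+\lambda^{-1}])$. For $k=1,2,\dots$: let $\psi_s^k=\lambda f+\frac12\|\cdot-z_{k-1}\|^2$; let $(z_k,\tilde v_k,\tilde\varepsilon_k)$ be the output of ACG1 with inputs $(\psi_s^k,\lambda h,z_{k-1},\mu,L)$ and $\sigma$. If $\|z_{k-1}-z_k+\tilde v_k\|\le\lambda\bar\rho/5$, then: let $(z,\tilde v,\tilde\varepsilon)$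 be the output of ACG2 with the same inputs and $\bar\eta=\lambda\bar\varepsilon$; put $L_\lambda=\max\{m,M\}+\lambda^{-1}$, $\hat z=\operatorname{argmin}_u\{\ell_f(u;z)+h(u)+\frac{L_\lambda}2\|u-z\|^2\}$, $\hat v=L_\lambda(z-\hat z)+\nabla f(\hat z)-\nabla f(z)$; stop and output $(\hat z,\hat v)$.
   Formalization: f is assumed in C_{m,M}(Ω) for a convex Ω ⊇ Z with nonempty interior that contains every point where the ACG calls evaluate ∇f; ACG2 continues the ACG1 call, its stopping tests being consulted only from the iteration at which ACG1 stopped. *)

theory Defs
  imports "HOL-Analysis.Analysis"
begin

section \<open>Function classes\<close>

definition grad :: "('a::euclidean_space \<Rightarrow> real) \<Rightarrow> 'a \<Rightarrow> 'a" where
  "grad f z = (THE D. GDERIV f z :> D)"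

definition linearization :: "('a::euclidean_space \<Rightarrow> real) \<Rightarrow> 'a \<Rightarrow> 'a \<Rightarrow> real" where
  "linearization f z u = f z + grad f z \<bullet> (u - z)"

text \<open>
  Differentiability is in the whole space also at boundary points of \<open>Z\<close>. Values of \<open>f\<close> away
  from \<open>Z\<close> are unconstrained, so taking \<open>f\<close> to be real-valued everywhere loses no generality.
\<close>
definition curvature_class :: "real \<Rightarrow> real \<Rightarrow> 'a::euclidean_space set \<Rightarrow> ('a \<Rightarrow> real) set" where
  "curvature_class m M Z =
     {f. (\<forall>z\<in>Z. GDERIV f z :> grad f z) \<and> continuous_on Z (grad f) \<and>
         (\<forall>u\<in>Z. \<forall>z\<in>Z. - (m / 2) * (norm (u - z))\<^sup>2 \<le> f u - linearization f z u \<and>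
                       f u - linearization f z u \<le> M / 2 * (norm (u - z))\<^sup>2)}"

definition Conv_bar :: "'a::euclidean_space set \<Rightarrow> ('a \<Rightarrow> ereal) set" where
  "Conv_bar Z =
     {h. (\<forall>x. h x \<noteq> -\<infinity>) \<and> (\<exists>x. h x \<noteq> \<infinity>) \<and> {x. \<bar>h x\<bar> \<noteq> \<infinity>} = Z \<and>
         (\<forall>x y. \<forall>t\<in>{0..1}. h ((1 - t) *\<^sub>R x + t *\<^sub>R y) \<le> ereal (1 - t) * h x + ereal t * h y) \<and>
         (\<forall>x. h x \<le> Liminf (at x) h)}"

definition subdifferential :: "('a::euclidean_space \<Rightarrow> ereal) \<Rightarrow> 'a \<Rightarrow> 'a set" where
  "subdifferential h x = {v. \<bar>h x\<bar> \<noteq> \<infinity> \<and> (\<forall>u. h x + ereal (v \<bullet> (u - x)) \<le> h u)}"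

definition composite :: "('a \<Rightarrow> real) \<Rightarrow> ('a \<Rightarrow> ereal) \<Rightarrow> 'a \<Rightarrow> ereal" where
  "composite f h z = ereal (f z) + h z"

definition prox_gap :: "real \<Rightarrow> ('a::euclidean_space \<Rightarrow> ereal) \<Rightarrow> 'a \<Rightarrow> ereal" where
  "prox_gap lam phi z0 =
     (INF u. ereal (1 / 2 * (norm (z0 - u))\<^sup>2) + ereal lam * (phi u - (INF z. phi z)))"

definition log1_plus :: "real \<Rightarrow> real" where
  "log1_plus t = max (ln t) 1"

text \<open>
  The universal constant is a fixed numeral: an existentially quantified constant in a theorem over
  a type variable \<open>'a\<close> could depend on \<open>'a\<close>, that is, on the dimension of the space. No sharpness
  is intended.
\<close>
definition bigO_const :: real where
  "bigO_const = 1000000"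

definition bigO_count :: "nat \<Rightarrow> ereal \<Rightarrow> bool" where
  "bigO_count N B \<longleftrightarrow> ereal (real N) \<le> ereal bigO_const * max 1 B"


section \<open>ACG iterations\<close>

text \<open>A state after \<open>k\<close> iterations is \<open>(A\<^sub>k, y\<^sub>k, x\<^sub>k, \<Gamma>\<^sub>k)\<close>.\<close>
type_synonym 'a acg_state = "real \<times> 'a \<times> 'a \<times> ('a \<Rightarrow> real)"

definition acg_a :: "real \<Rightarrow> real \<Rightarrow> real \<Rightarrow> real" where
  "acg_a mu L A = (let tau = (1 + mu * A) / L in (tau + sqrt (tau\<^sup>2 + 4 * tau * A)) / 2)"

definition acg_point :: "real \<Rightarrow> real \<Rightarrow> 'a::euclidean_space acg_state \<Rightarrow> 'a" where
  "acg_point mu L = (\<lambda>(A, y, x, \<Gamma>).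
     let a = acg_a mu L A; A' = A + a in (A / A') *\<^sub>R y + (a / A') *\<^sub>R x)"

definition acg_q ::
  "('a::euclidean_space \<Rightarrow> real) \<Rightarrow> ('a \<Rightarrow> ereal) \<Rightarrow> real \<Rightarrow> 'a \<Rightarrow> 'a \<Rightarrow> ereal" where
  "acg_q \<psi>s \<psi>n mu xt u =
     ereal (linearization \<psi>s xt u) + \<psi>n u + ereal (mu / 2 * (norm (u - xt))\<^sup>2)"

definition acg_step ::
  "('a::euclidean_space \<Rightarrow> real) \<Rightarrow> ('a \<Rightarrow> ereal) \<Rightarrow> real \<Rightarrow> real \<Rightarrow> 'a acg_state \<Rightarrow> 'a acg_state" where
  "acg_step \<psi>s \<psi>n mu L s = (case s of (A, y, x, \<Gamma>) \<Rightarrow>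
     let a = acg_a mu L A;
         A' = A + a;
         xt = acg_point mu L s;
         q = acg_q \<psi>s \<psi>n mu xt;
         y' = (ARG_MIN (\<lambda>u. ereal (1 / L) * q u + ereal (1 / 2 * (norm (u - xt))\<^sup>2)) u. True);
         x' = x + (a / (1 + mu * A')) *\<^sub>R (L *\<^sub>R (y' - xt) + mu *\<^sub>R (y' - x));
         \<gamma> = (\<lambda>u. real_of_ereal (q y') + L * ((xt - y') \<bullet> (u - y')) + mu / 2 * (norm (u - y'))\<^sup>2);
         \<Gamma>' = (\<lambda>u. A / A' * \<Gamma> u + a / A' * \<gamma> u)
     in (A', y', x', \<Gamma>'))"

primrec acg ::
  "('a::euclidean_space \<Rightarrow> real) \<Rightarrow> ('a \<Rightarrow> ereal) \<Rightarrow> 'a \<Rightarrow> real \<Rightarrow> real \<Rightarrow> nat \<Rightarrow> 'a acg_state" where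
  "acg \<psi>s \<psi>n y0 mu L 0 = (0, y0, y0, \<lambda>_. 0)"
| "acg \<psi>s \<psi>n y0 mu L (Suc k) = acg_step \<psi>s \<psi>n mu L (acg \<psi>s \<psi>n y0 mu L k)"

text \<open>The triple \<open>(y\<^sub>k, r\<^sub>k, \<eta>\<^sub>k)\<close>, for \<open>k \<ge> 1\<close>.\<close>
definition acg_output ::
  "('a::euclidean_space \<Rightarrow> real) \<Rightarrow> ('a \<Rightarrow> ereal) \<Rightarrow> 'a \<Rightarrow> real \<Rightarrow> real \<Rightarrow> nat \<Rightarrow> 'a \<times> 'a \<times> real" where
  "acg_output \<psi>s \<psi>n y0 mu L k = (case acg \<psi>s \<psi>n y0 mu L k of (A, y, x, \<Gamma>) \<Rightarrow>
     let r = (1 / A) *\<^sub>R (y0 - x)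
     in (y, r, real_of_ereal (composite \<psi>s \<psi>n y) - \<Gamma> x - r \<bullet> (y - x)))"

definition acg_relative_test ::
  "('a::euclidean_space \<Rightarrow> real) \<Rightarrow> ('a \<Rightarrow> ereal) \<Rightarrow> 'a \<Rightarrow> real \<Rightarrow> real \<Rightarrow> real \<Rightarrow> nat \<Rightarrow> bool" where
  "acg_relative_test \<psi>s \<psi>n y0 mu L \<sigma> k \<longleftrightarrow> (case acg_output \<psi>s \<psi>n y0 mu L k of (y, r, \<eta>) \<Rightarrow>
     (norm r)\<^sup>2 + 2 * \<eta> \<le> \<sigma> * (norm (y0 - y + r))\<^sup>2)"

definition first_from :: "nat \<Rightarrow> (nat \<Rightarrow> bool) \<Rightarrow> nat \<Rightarrow> bool" where
  "first_from n P k \<longleftrightarrow> n \<le> k \<and> P k \<and> (\<forall>j. n \<le> j \<and> j < k \<longrightarrow> \<not> P j)"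

definition acg1_stops_at ::
  "('a::euclidean_space \<Rightarrow> real) \<Rightarrow> ('a \<Rightarrow> ereal) \<Rightarrow> 'a \<Rightarrow> real \<Rightarrow> real \<Rightarrow> real \<Rightarrow> nat \<Rightarrow> bool" where
  "acg1_stops_at \<psi>s \<psi>n y0 mu L \<sigma> = first_from 1 (\<lambda>k.
     acg_relative_test \<psi>s \<psi>n y0 mu L \<sigma> k \<and> fst (acg \<psi>s \<psi>n y0 mu L k) \<ge> max 8 (9 / mu))"

text \<open>
  ACG2 continues the ACG1 call with the same inputs: its tests are consulted from the iteration
  \<open>k1\<close> at which ACG1 stopped. Since \<open>A\<^sub>k\<close> increases with \<open>k\<close>, this is the same as also
  requiring \<open>A\<^sub>k \<ge> max {8, 9/\<mu>}\<close>. If ACG2 may return earlier, the residual bound on the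
  method's output fails: for \<open>h = 0\<close>, \<open>f u = (299/2) u\<^sup>2\<close> on the real line, \<open>\<lambda> = 1\<close>, \<open>m = 1/2\<close>,
  \<open>M = 10\<^sup>6 - 1\<close>, target accuracy 1, \<open>\<sigma> = 1 - 10\<^sup>-\<^sup>6\<close> and starting point 3/100, it would return at
  its first iteration, and the final residual would exceed 8.
\<close>
definition acg2_stops_at ::
  "('a::euclidean_space \<Rightarrow> real) \<Rightarrow> ('a \<Rightarrow> ereal) \<Rightarrow> 'a \<Rightarrow> real \<Rightarrow> real \<Rightarrow> real \<Rightarrow> real \<Rightarrow> nat \<Rightarrow> nat \<Rightarrow> bool"
  where
  "acg2_stops_at \<psi>s \<psi>n y0 mu L \<sigma> \<eta>bar k1 = first_from k1 (\<lambda>k.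
     acg_relative_test \<psi>s \<psi>n y0 mu L \<sigma> k \<and> snd (snd (acg_output \<psi>s \<psi>n y0 mu L k)) \<le> \<eta>bar)"


section \<open>The AIPP method\<close>

definition prox_smooth :: "real \<Rightarrow> ('a::euclidean_space \<Rightarrow> real) \<Rightarrow> 'a \<Rightarrow> 'a \<Rightarrow> real" where
  "prox_smooth lam f z u = lam * f u + 1 / 2 * (norm (u - z))\<^sup>2"

definition scaled :: "real \<Rightarrow> ('a \<Rightarrow> ereal) \<Rightarrow> 'a \<Rightarrow> ereal" where
  "scaled lam h u = ereal lam * h u"

text \<open>
  The following specialize the ACG notions to the prox subproblem centred at \<open>z\<close>, with
  \<open>\<mu> = 1 - \<lambda>m\<close> and \<open>L = 1 + \<lambda>M\<close>.
\<close>

definition sub_point ::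
  "('a::euclidean_space \<Rightarrow> real) \<Rightarrow> ('a \<Rightarrow> ereal) \<Rightarrow> real \<Rightarrow> real \<Rightarrow> real \<Rightarrow> 'a \<Rightarrow> nat \<Rightarrow> 'a" where
  "sub_point f h m M lam z k = acg_point (1 - lam * m) (1 + lam * M)
     (acg (prox_smooth lam f z) (scaled lam h) z (1 - lam * m) (1 + lam * M) k)"

definition sub_output ::
  "('a::euclidean_space \<Rightarrow> real) \<Rightarrow> ('a \<Rightarrow> ereal) \<Rightarrow> real \<Rightarrow> real \<Rightarrow> real \<Rightarrow> 'a \<Rightarrow> nat \<Rightarrow> 'a \<times> 'a \<times> real" where
  "sub_output f h m M lam z k =
     acg_output (prox_smooth lam f z) (scaled lam h) z (1 - lam * m) (1 + lam * M) k"

definition sub_acg1 ::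
  "('a::euclidean_space \<Rightarrow> real) \<Rightarrow> ('a \<Rightarrow> ereal) \<Rightarrow> real \<Rightarrow> real \<Rightarrow> real \<Rightarrow> real \<Rightarrow> 'a \<Rightarrow> nat \<Rightarrow> bool" where
  "sub_acg1 f h m M lam \<sigma> z k1 \<longleftrightarrow>
     acg1_stops_at (prox_smooth lam f z) (scaled lam h) z (1 - lam * m) (1 + lam * M) \<sigma> k1"

definition sub_acg2 ::
  "('a::euclidean_space \<Rightarrow> real) \<Rightarrow> ('a \<Rightarrow> ereal) \<Rightarrow> real \<Rightarrow> real \<Rightarrow> real \<Rightarrow> real \<Rightarrow> real \<Rightarrow> 'a \<Rightarrow> nat \<Rightarrow> nat \<Rightarrow> bool"
  where
  "sub_acg2 f h m M lam \<rho> \<sigma> z k1 k2 \<longleftrightarrow>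
     (let \<epsilon>bar = \<rho>\<^sup>2 / (32 * (max m M + 1 / lam))
      in acg2_stops_at (prox_smooth lam f z) (scaled lam h) z (1 - lam * m) (1 + lam * M) \<sigma>
           (lam * \<epsilon>bar) k1 k2)"

definition residual_small ::
  "('a::euclidean_space \<Rightarrow> real) \<Rightarrow> ('a \<Rightarrow> ereal) \<Rightarrow> real \<Rightarrow> real \<Rightarrow> real \<Rightarrow> real \<Rightarrow> 'a \<Rightarrow> nat \<Rightarrow> bool" where
  "residual_small f h m M lam \<rho> z k1 \<longleftrightarrow> (case sub_output f h m M lam z k1 of (z', v, _) \<Rightarrow>
     let \<rho>bar = \<rho> / 4 in norm (z - z' + v) \<le> lam * \<rho>bar / 5)"

definition refine_point ::
  "('a::euclidean_space \<Rightarrow> real) \<Rightarrow> ('a \<Rightarrow> ereal) \<Rightarrow> real \<Rightarrow> real \<Rightarrow> real \<Rightarrow> 'a \<Rightarrow> 'a" where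
  "refine_point f h m M lam z =
     (let Llam = max m M + 1 / lam
      in ARG_MIN (\<lambda>u. ereal (linearization f z u) + h u + ereal (Llam / 2 * (norm (u - z))\<^sup>2)) u. True)"

definition refine_vector ::
  "('a::euclidean_space \<Rightarrow> real) \<Rightarrow> ('a \<Rightarrow> ereal) \<Rightarrow> real \<Rightarrow> real \<Rightarrow> real \<Rightarrow> 'a \<Rightarrow> 'a" where
  "refine_vector f h m M lam z =
     (let Llam = max m M + 1 / lam; zhat = refine_point f h m M lam z
      in Llam *\<^sub>R (z - zhat) + grad f zhat - grad f z)"

text \<open>
  \<open>aipp f h m M lam \<rho> \<sigma> z N zhat vhat\<close>: the method started with prox centre \<open>z\<close> stops, outputs
  \<open>(zhat, vhat)\<close>, and performs \<open>N\<close> ACG iterations in total, all iterations of both the ACG1 and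
  the ACG2 calls being counted.
\<close>
inductive aipp ::
  "('a::euclidean_space \<Rightarrow> real) \<Rightarrow> ('a \<Rightarrow> ereal) \<Rightarrow> real \<Rightarrow> real \<Rightarrow> real \<Rightarrow> real \<Rightarrow> real \<Rightarrow>
     'a \<Rightarrow> nat \<Rightarrow> 'a \<Rightarrow> 'a \<Rightarrow> bool"
  for f h m M lam \<rho> \<sigma>
where
  final: "sub_acg1 f h m M lam \<sigma> z k1 \<Longrightarrow> residual_small f h m M lam \<rho> z k1 \<Longrightarrow>
    sub_acg2 f h m M lam \<rho> \<sigma> z k1 k2 \<Longrightarrow> z' = fst (sub_output f h m M lam z k2) \<Longrightarrow>
    aipp f h m M lam \<rho> \<sigma> z (k1 + k2) (refine_point f h m M lam z') (refine_vector f h m M lam z')"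
| outer: "sub_acg1 f h m M lam \<sigma> z k1 \<Longrightarrow> \<not> residual_small f h m M lam \<rho> z k1 \<Longrightarrow>
    aipp f h m M lam \<rho> \<sigma> (fst (sub_output f h m M lam z k1)) N zhat vhat \<Longrightarrow>
    aipp f h m M lam \<rho> \<sigma> z (k1 + N) zhat vhat"

text \<open>The prox centres \<open>z\<^sub>0, z\<^sub>1, \<dots>\<close> at which the method starts an outer iteration.\<close>
inductive aipp_centre ::
  "('a::euclidean_space \<Rightarrow> real) \<Rightarrow> ('a \<Rightarrow> ereal) \<Rightarrow> real \<Rightarrow> real \<Rightarrow> real \<Rightarrow> real \<Rightarrow> real \<Rightarrow>
     'a \<Rightarrow> 'a \<Rightarrow> bool"
  for f h m M lam \<rho> \<sigma> z0
where
  init: "aipp_centre f h m M lam \<rho> \<sigma> z0 z0"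
| "next": "aipp_centre f h m M lam \<rho> \<sigma> z0 z \<Longrightarrow> sub_acg1 f h m M lam \<sigma> z k1 \<Longrightarrow>
    \<not> residual_small f h m M lam \<rho> z k1 \<Longrightarrow>
    aipp_centre f h m M lam \<rho> \<sigma> z0 (fst (sub_output f h m M lam z k1))"

text \<open>
  The points at which the ACG iterations actually performed by the method query \<open>f\<close> and its
  gradient. They are combinations of \<open>y\<^sub>k \<in> Z\<close> with the unconstrained \<open>x\<^sub>k\<close> and can lie
  outside \<open>Z\<close>, where membership of \<open>f\<close> in \<open>curvature_class m M Z\<close> says nothing. The regularity
  assumption on \<open>f\<close> is therefore stated on a convex set \<open>Omega\<close> containing \<open>Z\<close> and these points:
  \<open>Omega = UNIV\<close> if \<open>f\<close> is regular on the whole space, \<open>Omega = Z\<close> if the queries stay in \<open>Z\<close>.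
  Its interior has to be nonempty, since on a set without interior the curvature bounds do not
  control the normal component of the gradient, which enters \<open>refine_vector\<close>.
\<close>
inductive_set aipp_queries ::
  "('a::euclidean_space \<Rightarrow> real) \<Rightarrow> ('a \<Rightarrow> ereal) \<Rightarrow> real \<Rightarrow> real \<Rightarrow> real \<Rightarrow> real \<Rightarrow> real \<Rightarrow>
     'a \<Rightarrow> 'a set"
  for f h m M lam \<rho> \<sigma> z0
where
  acg1: "aipp_centre f h m M lam \<rho> \<sigma> z0 z \<Longrightarrow> (\<And>j. j \<le> k \<Longrightarrow> \<not> sub_acg1 f h m M lam \<sigma> z j) \<Longrightarrow>
    sub_point f h m M lam z k \<in> aipp_queries f h m M lam \<rho> \<sigma> z0"
| acg2: "aipp_centre f h m M lam \<rho> \<sigma> z0 z \<Longrightarrow> sub_acg1 f h m M lam \<sigma> z k1 \<Longrightarrow>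
    residual_small f h m M lam \<rho> z k1 \<Longrightarrow>
    (\<And>j. j \<le> k \<Longrightarrow> \<not> sub_acg2 f h m M lam \<rho> \<sigma> z k1 j) \<Longrightarrow>
    sub_point f h m M lam z k \<in> aipp_queries f h m M lam \<rho> \<sigma> z0"

end

theory Submission
  imports Defs
begin

text \<open>
  Each prox subproblem \<open>\<psi> = \<lambda>\<phi> + 1/2 |\<cdot> - z|\<^sup>2\<close> is \<open>\<mu>\<close>-strongly convex. The accelerated iterations keep
  \<open>A\<^sub>k \<Gamma>\<^sub>k \<le> A\<^sub>k \<psi>\<close> and \<open>A\<^sub>k \<psi>(y\<^sub>k) \<le> min (A\<^sub>k \<Gamma>\<^sub>k + 1/2 |\<cdot> - z|\<^sup>2)\<close>, so that \<open>r\<^sub>k\<close> is an \<open>\<eta>\<^sub>k\<close>-subgradient of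
  \<open>\<psi>\<close> at \<open>y\<^sub>k\<close> with \<open>|r\<^sub>k| \<le> 2 |y\<^sub>k - z| / A\<^sub>k\<close> and \<open>2 A\<^sub>k \<eta>\<^sub>k \<le> |y\<^sub>k - z|\<^sup>2\<close>. Since \<open>A\<^sub>k\<close> grows quadratically and
  geometrically, both stopping tests are met within the claimed number of iterations.

  The relative test makes every outer iteration decrease \<open>\<lambda>\<phi>\<close> by \<open>(1 - \<sigma>)/2\<close> times the squared residual,
  which is at least \<open>(\<lambda>\<rho>/20)\<^sup>2\<close> before the last one. After the first outer iteration the remaining gap
  \<open>\<lambda>(\<phi> - \<phi>\<^sub>*)\<close> is at most \<open>9/8\<close> times the prox gap at \<open>z\<^sub>0\<close>, which bounds the number of outer iterations.
  At the last one, the residual is an approximate subgradient of the strongly convex model minimized by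
  the refinement step, and the gradient of \<open>f\<close> is \<open>max {m, M}\<close>-Lipschitz; together they bound the output.
\<close>

section \<open>Quadratic identities in an inner product space\<close>

lemma norm_convex_combination_squared:
  fixes x y b :: "'a::real_inner"
  shows "(norm ((1 - t) *\<^sub>R x + t *\<^sub>R y - b))\<^sup>2 =
    (1 - t) * (norm (x - b))\<^sup>2 + t * (norm (y - b))\<^sup>2 - t * (1 - t) * (norm (x - y))\<^sup>2"
  unfolding power2_norm_eq_inner
  by (simp add: inner_commute algebra_simps inner_diff_left inner_diff_right inner_add_left inner_add_right)

lemma norm_diff_squared_expand:
  fixes u x b :: "'a::real_inner"
  shows "(norm (u - b))\<^sup>2 = (norm (x - b))\<^sup>2 + 2 * ((x - b) \<bullet> (u - x)) + (norm (u - x))\<^sup>2"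
  unfolding power2_norm_eq_inner
  by (simp add: inner_commute algebra_simps inner_diff_left inner_diff_right)

section \<open>Minimizers of strongly convex functions\<close>

text \<open>Without a minimizer, every point of \<open>K\<close> lies in an open set
  \<open>{u. F y < F u}\<close> with \<open>y\<close> in \<open>K\<close>. Among the finitely many
  \<open>y\<close> that suffice for a cover, the one of least value is itself uncovered.\<close>

lemma lsc_attains_min:
  fixes F :: "'a::topological_space \<Rightarrow> ereal"
  assumes "compact K" "K \<noteq> {}" and lsc: "\<And>a. open {u. a < F u}"
  shows "\<exists>x\<in>K. \<forall>y\<in>K. F x \<le> F y"
proof (rule ccontr)
  assume "\<not> ?thesis"
  then have cover: "K \<subseteq> (\<Union>y\<in>K. {u. F y < F u})"
    by (auto simp: not_le)
  obtain C where C: "C \<subseteq> K" "finite C" "K \<subseteq> (\<Union>y\<in>C. {u. F y < F u})"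
    using compactE_image[OF \<open>compact K\<close> _ cover] lsc by metis
  then have "C \<noteq> {}"
    using \<open>K \<noteq> {}\<close> by auto
  then obtain x where "x \<in> C" "\<forall>y\<in>C. F x \<le> F y"
    using C(2) by (metis (no_types, lifting) arg_min_if_finite(1) arg_min_if_finite(2) linorder_not_less)
  with C(1,3) show False
    by (metis (no_types, lifting) UN_iff linorder_not_less mem_Collect_eq subset_iff)
qed

definition strongly_convex_on :: "'a::real_normed_vector set \<Rightarrow> real \<Rightarrow> ('a \<Rightarrow> real) \<Rightarrow> bool" where
  "strongly_convex_on S \<beta> G \<longleftrightarrow> (\<forall>x\<in>S. \<forall>y\<in>S. \<forall>t\<in>{0..1}.
     G ((1 - t) *\<^sub>R x + t *\<^sub>R y) \<le> (1 - t) * G x + t * G y - \<beta> / 2 * (t * (1 - t)) * (norm (x - y))\<^sup>2)"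

lemma strongly_convex_onD:
  assumes "strongly_convex_on S \<beta> G" "x \<in> S" "y \<in> S" "0 \<le> t" "t \<le> 1"
  shows "G ((1 - t) *\<^sub>R x + t *\<^sub>R y) \<le> (1 - t) * G x + t * G y - \<beta> / 2 * (t * (1 - t)) * (norm (x - y))\<^sup>2"
  using assms unfolding strongly_convex_on_def by auto

text \<open>Compare \<open>x\<close> with the point at parameter \<open>t\<close> on the way to
  \<open>u\<close>, divide by \<open>t\<close> and let \<open>t\<close> tend to 0; the factor
  \<open>1 - t\<close> in front of the modulus disappears in the limit.\<close>

lemma strongly_convex_minimizer_growth:
  assumes sc: "strongly_convex_on S \<beta> G" and "convex S" "x \<in> S" "u \<in> S"
    and min: "\<And>v. v \<in> S \<Longrightarrow> G x \<le> G v"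
  shows "G x + \<beta> / 2 * (norm (u - x))\<^sup>2 \<le> G u"
proof -
  let ?n = "\<beta> / 2 * (norm (u - x))\<^sup>2"
  have "(1 - t) * ?n \<le> G u - G x" if "0 < t" "t < 1" for t
  proof -
    have "G x \<le> G ((1 - t) *\<^sub>R x + t *\<^sub>R u)"
      using that assms by (intro min) (simp add: convexD)
    also have "\<dots> \<le> (1 - t) * G x + t * G u - \<beta> / 2 * (t * (1 - t)) * (norm (x - u))\<^sup>2"
      using that assms by (intro strongly_convex_onD[OF sc]) auto
    finally have "t * ((1 - t) * ?n) \<le> t * (G u - G x)"
      by (simp add: algebra_simps norm_minus_commute)
    then show ?thesis
      using that by simp
  qed
  moreover have "((\<lambda>t. (1 - t) * ?n) \<longlongrightarrow> (1 - 0) * ?n) (at_right 0)"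
    by (intro tendsto_intros)
  moreover have "\<forall>\<^sub>F t in at_right (0::real). 0 < t \<and> t < 1"
    using eventually_at_right_real[of 0 "1::real"] by simp
  ultimately have "(1 - 0) * ?n \<le> G u - G x"
    by (intro tendsto_upperbound[where F = "at_right 0" and f = "\<lambda>t. (1 - t) * ?n"])
      (auto elim: eventually_mono)
  then show ?thesis
    by simp
qed

text \<open>Coercivity comes from strong convexity: the minimum over the unit ball around
  \<open>x0\<close> bounds \<open>G\<close> from below at the unit point towards \<open>u\<close>,
  and the modulus then forces \<open>G u\<close> above \<open>G x0\<close> when \<open>u\<close> is
  far away. A compact ball remains to be searched.\<close>

lemma strongly_convex_minimizer_exists:
  fixes F :: "'a::euclidean_space \<Rightarrow> ereal"
  assumes sc: "strongly_convex_on S \<beta> G" and S: "convex S" "S \<noteq> {}" and "\<beta> > 0"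
    and lsc: "\<And>a. open {u. a < F u}"
    and F: "\<And>u. u \<in> S \<Longrightarrow> F u = ereal (G u)" "\<And>u. u \<notin> S \<Longrightarrow> F u = \<infinity>"
  obtains x where "x \<in> S" "\<And>u. u \<in> S \<Longrightarrow> G x \<le> G u"
proof -
  obtain x0 where x0: "x0 \<in> S"
    using S by auto
  obtain p where p: "p \<in> cball x0 1" "\<forall>y\<in>cball x0 1. F p \<le> F y"
    using lsc_attains_min[OF _ _ lsc, of "cball x0 1"] by auto
  have "F p \<le> F x0"
    using p(2) by simp
  then have pS: "p \<in> S"
    using F(2) F(1)[OF x0] by fastforce
  define D where "D = G x0 - G p"
  have "D \<ge> 0"
    using \<open>F p \<le> F x0\<close> F x0 pS by (simp add: D_def)
  \<comment> \<open>This radius gives \<open>\<beta> / 2 * (R - 1) = D + \<beta> / 2\<close>, so the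
    quadratic gain beats the drop \<open>D\<close>.\<close>
  define R where "R = 2 + 2 * D / \<beta>"
  have R: "R \<ge> 2" "\<beta> / 2 * (R - 1) > D"
    using \<open>D \<ge> 0\<close> \<open>\<beta> > 0\<close> by (auto simp: R_def field_simps)
  have far: "G x0 \<le> G u" if u: "u \<in> S" "dist x0 u > R" for u
  proof -
    define r where "r = norm (u - x0)"
    have r: "r > R"
      using u by (simp add: r_def dist_norm norm_minus_commute)
    \<comment> \<open>The point of the segment at distance 1 from \<open>x0\<close>, where
      \<open>G p\<close> is a lower bound.\<close>
    define q where "q = (1 - 1 / r) *\<^sub>R x0 + (1 / r) *\<^sub>R u"
    have "q - x0 = (1 / r) *\<^sub>R (u - x0)"
      by (simp add: q_def algebra_simps)
    then have "norm (q - x0) = \<bar>1 / r\<bar> * r"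
      by (simp add: r_def)
    then have "norm (q - x0) = 1"
      using r R by simp
    then have "q \<in> cball x0 1"
      by (simp add: dist_norm norm_minus_commute)
    moreover have "q \<in> S"
      unfolding q_def using r R u x0 S by (intro convexD) simp_all
    ultimately have "G p \<le> G q"
      using p(2) F(1)[OF pS] F(1)[of q] by (metis ereal_less_eq(3))
    also have "\<dots> \<le> (1 - 1 / r) * G x0 + 1 / r * G u - \<beta> / 2 * (1 / r * (1 - 1 / r)) * (norm (x0 - u))\<^sup>2"
      unfolding q_def using r R u x0 by (intro strongly_convex_onD[OF sc]) simp_all
    also have "(norm (x0 - u))\<^sup>2 = r\<^sup>2"
      by (simp add: r_def norm_minus_commute)
    finally have "r * G p \<le> r * ((1 - 1 / r) * G x0 + 1 / r * G u - \<beta> / 2 * (1 / r * (1 - 1 / r)) * r\<^sup>2)"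
      using r R by (intro mult_left_mono) auto
    also have "\<dots> = (r - 1) * G x0 + G u - r * (\<beta> / 2 * (r - 1))"
      using r R by (simp add: field_simps power2_eq_square)
    finally have "r * (\<beta> / 2 * (r - 1) - D) \<le> G u - G x0"
      by (simp add: D_def algebra_simps)
    moreover have "\<beta> / 2 * (r - 1) - D \<ge> 0"
      using R r \<open>\<beta> > 0\<close> mult_left_mono[of "R - 1" "r - 1" "\<beta> / 2"] by linarith
    ultimately show ?thesis
      using r R by (smt (verit) mult_nonneg_nonneg)
  qed
  obtain x where x: "x \<in> cball x0 R" "\<forall>y\<in>cball x0 R. F x \<le> F y"
    using lsc_attains_min[OF _ _ lsc, of "cball x0 R"] R by auto
  have "F x \<le> F x0"
    using x(2) R(1) by simp
  then have xS: "x \<in> S"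
    using F(2) F(1)[OF x0] by fastforce
  have "G x \<le> G u" if "u \<in> S" for u
  proof (cases "dist x0 u > R")
    case True
    then show ?thesis
      using far[OF that] \<open>F x \<le> F x0\<close> F(1)[OF x0] F(1)[OF xS] by simp
  next
    case False
    then show ?thesis
      using x(2)[rule_format, of u] F(1)[OF xS] F(1)[OF that] by (simp add: not_less)
  qed
  with xS that show thesis
    by blast
qed

section \<open>Convex lower semicontinuous functions with domain \<open>Z\<close>\<close>

lemma Conv_bar_nonempty:
  assumes "h \<in> Conv_bar Z"
  shows "Z \<noteq> {}"
proof -
  obtain x where "h x \<noteq> \<infinity>" "h x \<noteq> -\<infinity>"
    using assms unfolding Conv_bar_def by blast
  then have "\<bar>h x\<bar> \<noteq> \<infinity>"
    by (cases "h x") auto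
  then show ?thesis
    using assms unfolding Conv_bar_def by blast
qed

lemma Conv_bar_outside: "h \<in> Conv_bar Z \<Longrightarrow> x \<notin> Z \<Longrightarrow> h x = \<infinity>"
  unfolding Conv_bar_def by auto

lemma Conv_bar_inside: "h \<in> Conv_bar Z \<Longrightarrow> x \<in> Z \<Longrightarrow> h x = ereal (real_of_ereal (h x))"
  unfolding Conv_bar_def by (auto simp: ereal_real)

lemma Conv_bar_not_MInfty: "h \<in> Conv_bar Z \<Longrightarrow> h x \<noteq> -\<infinity>"
  unfolding Conv_bar_def by auto

lemma Conv_bar_convex_combination:
  assumes h: "h \<in> Conv_bar Z" and "x \<in> Z" "y \<in> Z" "0 \<le> t" "t \<le> 1"
  shows "(1 - t) *\<^sub>R x + t *\<^sub>R y \<in> Z"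
    and "real_of_ereal (h ((1 - t) *\<^sub>R x + t *\<^sub>R y))
      \<le> (1 - t) * real_of_ereal (h x) + t * real_of_ereal (h y)"
proof -
  let ?v = "(1 - t) *\<^sub>R x + t *\<^sub>R y"
  have "h ?v \<le> ereal (1 - t) * h x + ereal t * h y"
    using assms unfolding Conv_bar_def by auto
  also have "\<dots> = ereal ((1 - t) * real_of_ereal (h x) + t * real_of_ereal (h y))"
    by (subst (1 2) Conv_bar_inside[OF h]) (use assms in auto)
  finally have *: "h ?v \<le> ereal ((1 - t) * real_of_ereal (h x) + t * real_of_ereal (h y))" .
  then show "?v \<in> Z"
    using Conv_bar_outside[OF h, of ?v] by fastforce
  then show "real_of_ereal (h ?v) \<le> (1 - t) * real_of_ereal (h x) + t * real_of_ereal (h y)"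
    using * Conv_bar_inside[OF h] by (metis ereal_less_eq(3))
qed

lemma Conv_bar_convex: "h \<in> Conv_bar Z \<Longrightarrow> convex Z"
  unfolding convex_alt using Conv_bar_convex_combination(1) by blast

lemma Conv_bar_open_superlevel:
  assumes "h \<in> Conv_bar Z"
  shows "open {u. a < h u}"
proof (subst open_subopen, clarify)
  fix x assume a: "a < h x"
  also have "h x \<le> Liminf (at x) h"
    using assms unfolding Conv_bar_def by auto
  finally have "\<forall>\<^sub>F u in at x. a < h u"
    by (rule less_LiminfD)
  \<comment> \<open>The limit inferior sees only punctured neighbourhoods; the assumption at
    \<open>x\<close> itself fills the hole.\<close>
  with a have "\<forall>\<^sub>F u in nhds x. a < h u"
    by (auto simp: eventually_at_filter elim!: eventually_mono)
  then show "\<exists>T. open T \<and> x \<in> T \<and> T \<subseteq> {u. a < h u}"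
    unfolding eventually_nhds by auto
qed

text \<open>The condition is solved for \<open>h u\<close>. A real \<open>s\<close> strictly between
  the two sides then splits it into two open conditions, one on \<open>h\<close> and one on the
  continuous part.\<close>

lemma open_superlevel_continuous_plus:
  fixes h :: "'a::euclidean_space \<Rightarrow> ereal"
  assumes h: "h \<in> Conv_bar Z" and g: "continuous_on UNIV g" and "c > 0"
  shows "open {u. a < ereal (g u) + ereal c * h u}"
proof (cases a)
  case PInf
  then show ?thesis by simp
next
  case MInf
  have "- \<infinity> < ereal (g u) + ereal c * h u" for u
    using Conv_bar_not_MInfty[OF h, of u] \<open>c > 0\<close> by (cases "h u") auto
  then show ?thesis
    using MInf by simp
next
  case (real y)
  have *: "a < ereal (g u) + ereal c * h u \<longleftrightarrow> ereal ((y - g u) / c) < h u" for u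
    using \<open>c > 0\<close> real Conv_bar_not_MInfty[OF h, of u] by (cases "h u") (auto simp: field_simps)
  have t: "continuous_on UNIV (\<lambda>u. (y - g u) / c)"
    using \<open>c > 0\<close> by (intro continuous_intros g) auto
  show ?thesis
  proof (subst open_subopen, clarify)
    fix x assume "a < ereal (g x) + ereal c * h x"
    then obtain s where s: "ereal ((y - g x) / c) < ereal s" "ereal s < h x"
      unfolding * using ereal_dense2 by blast
    have "open {u. ereal s < h u}"
      by (rule Conv_bar_open_superlevel[OF h])
    moreover have "open {u. (y - g u) / c < s}"
      by (intro open_Collect_less t continuous_intros)
    ultimately have "open ({u. ereal s < h u} \<inter> {u. (y - g u) / c < s})"
      by blast
    moreover have "{u. ereal s < h u} \<inter> {u. (y - g u) / c < s} \<subseteq> {u. a < ereal (g u) + ereal c * h u}"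
      unfolding * by (auto intro: order.strict_trans[of _ "ereal s"])
    ultimately show "\<exists>T. open T \<and> x \<in> T \<and> T \<subseteq> {u. a < ereal (g u) + ereal c * h u}"
      using s by (intro exI[of _ "{u. ereal s < h u} \<inter> {u. (y - g u) / c < s}"]) auto
  qed
qed

text \<open>The linear term is affine and the square meets its strong convexity inequality with
  equality, so all slack comes from the convexity of \<open>h\<close>.\<close>

lemma strongly_convex_on_quadratic_plus:
  fixes h :: "'a::euclidean_space \<Rightarrow> ereal"
  assumes h: "h \<in> Conv_bar Z" and "c > 0"
  shows "strongly_convex_on Z \<beta>
    (\<lambda>u. k + p \<bullet> (u - b) + \<beta> / 2 * (norm (u - b))\<^sup>2 + c * real_of_ereal (h u))"
  unfolding strongly_convex_on_def
proof (intro ballI)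
  fix x y and t :: real
  assume *: "x \<in> Z" "y \<in> Z" "t \<in> {0..1}"
  let ?v = "(1 - t) *\<^sub>R x + t *\<^sub>R y" and ?H = "\<lambda>u. real_of_ereal (h u)"
  have "c * ?H ?v \<le> c * ((1 - t) * ?H x + t * ?H y)"
    using Conv_bar_convex_combination(2)[OF h, of x y t] * \<open>c > 0\<close> by simp
  moreover have "p \<bullet> (?v - b) = (1 - t) * (p \<bullet> (x - b)) + t * (p \<bullet> (y - b))"
    by (simp add: inner_diff_right inner_add_right algebra_simps)
  moreover have "(1 - t) * (k + px + \<beta> / 2 * X + c * hx) + t * (k + py + \<beta> / 2 * Y + c * hy)
      - \<beta> / 2 * (t * (1 - t)) * D
    = k + ((1 - t) * px + t * py) + \<beta> / 2 * ((1 - t) * X + t * Y - t * (1 - t) * D)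
      + c * ((1 - t) * hx + t * hy)" for px py X Y hx hy D
    by (simp add: field_simps)
  ultimately show "k + p \<bullet> (?v - b) + \<beta> / 2 * (norm (?v - b))\<^sup>2 + c * ?H ?v
    \<le> (1 - t) * (k + p \<bullet> (x - b) + \<beta> / 2 * (norm (x - b))\<^sup>2 + c * ?H x)
      + t * (k + p \<bullet> (y - b) + \<beta> / 2 * (norm (y - b))\<^sup>2 + c * ?H y)
      - \<beta> / 2 * (t * (1 - t)) * (norm (x - y))\<^sup>2"
    unfolding norm_convex_combination_squared by simp
qed

text \<open>Shared by the prox step of the iterations and the refinement step, whose objectives are
  both a quadratic plus a multiple of \<open>h\<close>. \<open>G\<close> is the real form of
  \<open>F\<close> on \<open>Z\<close>, in which the growth bound can be stated.\<close>

lemma quadratic_plus_argmin: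
  fixes h :: "'a::euclidean_space \<Rightarrow> ereal"
  assumes h: "h \<in> Conv_bar Z" and "c > 0" "\<beta> > 0"
    and F: "\<And>u. F u = ereal (k + p \<bullet> (u - b) + \<beta> / 2 * (norm (u - b))\<^sup>2) + ereal c * h u"
    and G: "\<And>u. G u = k + p \<bullet> (u - b) + \<beta> / 2 * (norm (u - b))\<^sup>2 + c * real_of_ereal (h u)"
  shows "(ARG_MIN F u. True) \<in> Z"
    and "u \<in> Z \<Longrightarrow> G (ARG_MIN F u. True) + \<beta> / 2 * (norm (u - (ARG_MIN F u. True)))\<^sup>2 \<le> G u"
proof -
  have sc: "strongly_convex_on Z \<beta> G"
    using strongly_convex_on_quadratic_plus[OF h \<open>c > 0\<close>, of \<beta> k p b] unfolding G[abs_def] .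
  have FZ: "F u = ereal (G u)" if "u \<in> Z" for u
    unfolding F G using Conv_bar_inside[OF h that] by (metis plus_ereal.simps(1) times_ereal.simps(1))
  have Fn: "F u = \<infinity>" if "u \<notin> Z" for u
    unfolding F using Conv_bar_outside[OF h that] \<open>c > 0\<close> by simp
  have "open {u. a < F u}" for a
    unfolding F by (intro open_superlevel_continuous_plus[OF h _ \<open>c > 0\<close>] continuous_intros)
  then obtain x where x: "x \<in> Z" "\<And>u. u \<in> Z \<Longrightarrow> G x \<le> G u"
    using strongly_convex_minimizer_exists[OF sc Conv_bar_convex[OF h] Conv_bar_nonempty[OF h] \<open>\<beta> > 0\<close>]
      FZ Fn by metis
  \<comment> \<open>\<open>ARG_MIN\<close> is a choice operator; it denotes a minimizer because one
    exists.\<close>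
  have "is_arg_min F (\<lambda>_. True) x"
    unfolding is_arg_min_linorder using x FZ Fn by (metis ereal_less_eq(1,3))
  then have am: "F (ARG_MIN F u. True) \<le> F u" for u
    unfolding arg_min_def by (metis (no_types, lifting) is_arg_min_linorder someI_ex)
  show Z: "(ARG_MIN F u. True) \<in> Z"
    using am[of x] FZ[OF x(1)] Fn by (metis PInfty_neq_ereal(1) ereal_infty_less_eq(1))
  show "G (ARG_MIN F u. True) + \<beta> / 2 * (norm (u - (ARG_MIN F u. True)))\<^sup>2 \<le> G u" if "u \<in> Z"
    using am FZ Z that
    by (intro strongly_convex_minimizer_growth[OF sc Conv_bar_convex[OF h]]) (metis ereal_less_eq(3))+
qed

section \<open>The accelerated gradient iterations\<close>

lemma acg_a_pos:
  assumes "mu > 0" "L > 0" "A \<ge> 0"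
  shows "acg_a mu L A > 0"
proof -
  have "(1 + mu * A) / L > 0"
    using assms by (simp add: add_pos_nonneg)
  then show ?thesis
    using assms unfolding acg_a_def Let_def by (simp add: add_pos_nonneg)
qed

text \<open>The step is the positive root of \<open>a\<^sup>2 = \<tau> * (A + a)\<close>. In this
  form it later matches the smoothness term with the curvature of the estimate function.\<close>

lemma acg_a_squared:
  assumes "mu > 0" "L > 0" "A \<ge> 0"
  shows "L * (acg_a mu L A)\<^sup>2 = (1 + mu * A) * (A + acg_a mu L A)"
proof -
  define \<tau> where "\<tau> = (1 + mu * A) / L"
  have \<tau>: "\<tau> > 0"
    using assms by (simp add: \<tau>_def add_pos_nonneg)
  define s where "s = sqrt (\<tau>\<^sup>2 + 4 * \<tau> * A)"
  have s: "s\<^sup>2 = \<tau>\<^sup>2 + 4 * \<tau> * A"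
    unfolding s_def using \<tau> assms by (intro real_sqrt_pow2) simp
  have a: "acg_a mu L A = (\<tau> + s) / 2"
    unfolding acg_a_def Let_def \<tau>_def s_def by simp
  have "(acg_a mu L A)\<^sup>2 = \<tau> * (A + acg_a mu L A)"
    unfolding a using s by (simp add: field_simps power2_eq_square)
  then show ?thesis
    using assms by (simp add: \<tau>_def)
qed

text \<open>Dropping \<open>\<tau>\<^sup>2\<close> under the root leaves the part that drives both
  growth rates.\<close>

lemma acg_a_ge:
  assumes "mu > 0" "L > 0" "A \<ge> 0"
  defines "\<tau> \<equiv> (1 + mu * A) / L"
  shows "acg_a mu L A \<ge> \<tau> / 2 + sqrt (\<tau> * A)"
proof -
  have "\<tau> > 0"
    using assms by (simp add: add_pos_nonneg)
  have "2 * sqrt (\<tau> * A) = sqrt (4 * (\<tau> * A))"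
    by (simp add: real_sqrt_mult)
  also have "\<dots> \<le> sqrt (\<tau>\<^sup>2 + 4 * \<tau> * A)"
    by (intro real_sqrt_le_mono) simp
  finally show ?thesis
    unfolding acg_a_def Let_def \<tau>_def[symmetric] by simp
qed

abbreviation acg_A where
  "acg_A \<psi>s \<psi>n y0 mu L k \<equiv> fst (acg \<psi>s \<psi>n y0 mu L k)"

lemma acg_A_Suc:
  "acg_A \<psi>s \<psi>n y0 mu L (Suc k) = acg_A \<psi>s \<psi>n y0 mu L k + acg_a mu L (acg_A \<psi>s \<psi>n y0 mu L k)"
  by (simp add: acg_step_def Let_def split: prod.split)

lemma acg_A_nonneg:
  assumes "mu > 0" "L > 0"
  shows "acg_A \<psi>s \<psi>n y0 mu L k \<ge> 0"
proof (induction k)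
  case (Suc k)
  then show ?case
    unfolding acg_A_Suc using acg_a_pos[OF assms Suc] by simp
qed simp

lemma acg_A_mono:
  assumes "mu > 0" "L > 0" "j \<le> k"
  shows "acg_A \<psi>s \<psi>n y0 mu L j \<le> acg_A \<psi>s \<psi>n y0 mu L k"
  using assms(3)
proof (induction rule: dec_induct)
  case (step n)
  then show ?case
    unfolding acg_A_Suc using acg_a_pos[OF assms(1,2) acg_A_nonneg[OF assms(1,2)]]
    by (meson add_increasing2 less_imp_le)
qed simp

text \<open>By \<open>\<tau> \<ge> 1 / L\<close>, the square root of the weight gains at least
  \<open>1 / (2 * sqrt L)\<close> in each step.\<close>

lemma acg_A_quadratic_growth:
  assumes "mu > 0" "L > 0"
  shows "(real k)\<^sup>2 / (4 * L) \<le> acg_A \<psi>s \<psi>n y0 mu L k"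
proof -
  have "real k / (2 * sqrt L) \<le> sqrt (acg_A \<psi>s \<psi>n y0 mu L k)"
  proof (induction k)
    case (Suc k)
    let ?A = "acg_A \<psi>s \<psi>n y0 mu L k"
    have A: "?A \<ge> 0"
      by (rule acg_A_nonneg[OF assms])
    have "1 / L \<le> (1 + mu * ?A) / L"
      using assms A by (intro divide_right_mono) auto
    then have "1 / L / 2 \<le> (1 + mu * ?A) / L / 2"
      using assms A by (intro divide_right_mono) simp_all
    moreover have "sqrt (1 / L * ?A) \<le> sqrt ((1 + mu * ?A) / L * ?A)"
      using assms A \<open>1 / L \<le> (1 + mu * ?A) / L\<close> by (intro real_sqrt_le_mono mult_right_mono)
    ultimately have "1 / L / 2 + sqrt (1 / L * ?A) \<le> acg_a mu L ?A"
      using acg_a_ge[OF assms A] by linarith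
    then have "1 / (2 * L) + sqrt (?A / L) \<le> acg_a mu L ?A"
      by (simp add: mult.commute)
    then have "(sqrt ?A + 1 / (2 * sqrt L))\<^sup>2 \<le> ?A + acg_a mu L ?A"
    proof -
      have "(sqrt ?A + 1 / (2 * sqrt L))\<^sup>2 = ?A + sqrt (?A / L) + 1 / (4 * L)"
        using assms A unfolding power2_sum by (simp add: real_sqrt_divide power_divide power_mult_distrib)
      moreover have "1 / (4 * L) \<le> 1 / (2 * L)"
        using assms by (simp add: field_simps)
      ultimately show ?thesis
        using \<open>1 / (2 * L) + sqrt (?A / L) \<le> acg_a mu L ?A\<close> by linarith
    qed
    then have "sqrt ?A + 1 / (2 * sqrt L) \<le> sqrt (acg_A \<psi>s \<psi>n y0 mu L (Suc k))"
      unfolding acg_A_Suc by (rule real_le_rsqrt)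
    then show ?case
      using Suc.IH by (simp add: add_divide_distrib)
  qed simp
  then have "(real k / (2 * sqrt L))\<^sup>2 \<le> (sqrt (acg_A \<psi>s \<psi>n y0 mu L k))\<^sup>2"
    using assms by (intro power_mono) auto
  then show ?thesis
    unfolding real_sqrt_pow2[OF acg_A_nonneg[OF assms]]
    using assms by (simp add: power_divide power_mult_distrib)
qed

text \<open>The increment is at least \<open>sqrt (\<tau> * A) \<ge> A * sqrt (mu / L)\<close>, a
  fixed fraction of \<open>A\<close>. The index is shifted because the first positive weight is
  \<open>A\<^sub>1 = 1 / L\<close>.\<close>

lemma acg_A_geometric_growth:
  assumes "mu > 0" "L > 0"
  shows "(1 + sqrt (mu / L)) ^ k / L \<le> acg_A \<psi>s \<psi>n y0 mu L (Suc k)"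
proof (induction k)
  case 0
  then show ?case
    using assms unfolding acg_A_Suc by (simp add: acg_a_def)
next
  case (Suc k)
  let ?A = "acg_A \<psi>s \<psi>n y0 mu L (Suc k)"
  have A: "?A \<ge> 0"
    by (rule acg_A_nonneg[OF assms])
  have "?A * sqrt (mu / L) = sqrt (mu * ?A / L * ?A)"
    using A by (simp add: real_sqrt_mult real_sqrt_divide)
  also have "\<dots> \<le> sqrt ((1 + mu * ?A) / L * ?A)"
    using assms A by (intro real_sqrt_le_mono mult_right_mono divide_right_mono) auto
  also have "\<dots> \<le> acg_a mu L ?A"
    using acg_a_ge[OF assms A] assms A by (smt (verit) divide_nonneg_nonneg mult_nonneg_nonneg)
  finally have "?A * (1 + sqrt (mu / L)) \<le> acg_A \<psi>s \<psi>n y0 mu L (Suc (Suc k))"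
    unfolding acg_A_Suc[of _ _ _ _ _ "Suc k"] by (simp add: algebra_simps)
  moreover have "(1 + sqrt (mu / L)) ^ k / L * (1 + sqrt (mu / L)) \<le> ?A * (1 + sqrt (mu / L))"
    using Suc.IH assms by (intro mult_right_mono) auto
  ultimately show ?case
    by (simp add: mult.commute)
qed

text \<open>Inverts the geometric bound by \<open>ln (1 + s) \<ge> s / 2\<close>, which holds for
  \<open>s = sqrt (mu / L)\<close> because \<open>s \<le> 1\<close>.\<close>

lemma acg_A_ge_ln:
  assumes "0 < mu" "mu \<le> L" "B > 0" "real k \<ge> 2 * sqrt (L / mu) * ln (B * L)"
  shows "acg_A \<psi>s \<psi>n y0 mu L (Suc k) \<ge> B"
proof -
  define s where "s = sqrt (mu / L)"
  have L: "L > 0"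
    using assms by simp
  have s: "0 < s" "s \<le> 1" "1 / s = sqrt (L / mu)"
    using assms by (auto simp: s_def real_sqrt_divide)
  have "ln (inverse (1 + s)) \<le> inverse (1 + s) - 1"
    using s by (intro ln_le_minus_one) simp
  then have "1 - inverse (1 + s) \<le> ln (1 + s)"
    using s by (simp add: ln_inverse)
  moreover have "s / 2 \<le> 1 - inverse (1 + s)"
    using s by (simp add: field_simps)
  ultimately have ln: "s / 2 \<le> ln (1 + s)"
    by simp
  have "ln (B * L) \<le> real k * (s / 2)"
    using assms(4) s unfolding s(3)[symmetric] by (simp add: field_simps)
  also have "\<dots> \<le> real k * ln (1 + s)"
    using ln by (intro mult_left_mono) auto
  also have "\<dots> = ln ((1 + s) ^ k)"
    using s by (simp add: ln_realpow)
  finally have "B * L \<le> (1 + s) ^ k"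
    using assms s L by (subst (asm) ln_le_cancel_iff) auto
  then have "B \<le> (1 + s) ^ k / L"
    using L by (simp add: field_simps)
  also have "\<dots> \<le> acg_A \<psi>s \<psi>n y0 mu L (Suc k)"
    unfolding s_def by (rule acg_A_geometric_growth[OF assms(1) L])
  finally show ?thesis .
qed

section \<open>Estimate functions and the invariant of one accelerated run\<close>

locale acg_problem =
  fixes \<psi>s :: "'a::euclidean_space \<Rightarrow> real" and h :: "'a \<Rightarrow> ereal" and Z :: "'a set"
    and lam :: real and y0 :: 'a and mu L :: real
  assumes h: "h \<in> Conv_bar Z" and lam: "lam > 0" and y0: "y0 \<in> Z" and mu: "mu > 0" and L: "L > 0"
begin

definition \<psi> :: "'a \<Rightarrow> real" where
  "\<psi> u = \<psi>s u + lam * real_of_ereal (h u)"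

text \<open>A query point \<open>x\<close> may lie outside \<open>Z\<close>; the curvature bounds
  are therefore demanded for each query separately, from \<open>x\<close> to the points of
  \<open>Z\<close>.\<close>

definition regular_at :: "'a \<Rightarrow> bool" where
  "regular_at x \<longleftrightarrow> (\<forall>u\<in>Z. linearization \<psi>s x u + mu / 2 * (norm (u - x))\<^sup>2 \<le> \<psi>s u \<and>
     \<psi>s u \<le> linearization \<psi>s x u + L / 2 * (norm (u - x))\<^sup>2)"

abbreviation state :: "nat \<Rightarrow> 'a acg_state" where
  "state \<equiv> acg \<psi>s (scaled lam h) y0 mu L"

abbreviation out :: "nat \<Rightarrow> 'a \<times> 'a \<times> real" where
  "out \<equiv> acg_output \<psi>s (scaled lam h) y0 mu L"

text \<open>State \<open>k\<close> is built from the queries of the earlier states, hence the strict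
  bound.\<close>

definition regular_until :: "nat \<Rightarrow> bool" where
  "regular_until k \<longleftrightarrow> (\<forall>i<k. regular_at (acg_point mu L (state i)))"

definition Q :: "'a \<Rightarrow> 'a \<Rightarrow> real" where
  "Q x u = linearization \<psi>s x u + lam * real_of_ereal (h u) + mu / 2 * (norm (u - x))\<^sup>2"

definition prox_point :: "'a \<Rightarrow> 'a" where
  "prox_point x =
     (ARG_MIN (\<lambda>u. ereal (1 / L) * acg_q \<psi>s (scaled lam h) mu x u + ereal (1 / 2 * (norm (u - x))\<^sup>2)) u. True)"

lemma acg_q_eq:
  assumes "u \<in> Z"
  shows "acg_q \<psi>s (scaled lam h) mu x u = ereal (Q x u)"
  unfolding acg_q_def scaled_def Q_def
  by (subst Conv_bar_inside[OF h assms]) simp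

text \<open>The prox objective times \<open>L\<close> has modulus \<open>mu + L\<close>. Expanding
  its growth inequality around the minimizer cancels the part of modulus \<open>L\<close>; the rest
  says that the model \<open>\<gamma>\<close> lies below \<open>q\<close> on
  \<open>Z\<close>.\<close>

lemma prox_point:
  shows "prox_point x \<in> Z"
    and "u \<in> Z \<Longrightarrow> Q x (prox_point x) + L * ((x - prox_point x) \<bullet> (u - prox_point x))
      + mu / 2 * (norm (u - prox_point x))\<^sup>2 \<le> Q x u"
proof -
  define F where "F = (\<lambda>u. ereal (1 / L) * acg_q \<psi>s (scaled lam h) mu x u + ereal (1 / 2 * (norm (u - x))\<^sup>2))"
  define G where "G = (\<lambda>u. Q x u / L + 1 / 2 * (norm (u - x))\<^sup>2)"
  have F: "F u = ereal (\<psi>s x / L + (grad \<psi>s x /\<^sub>R L) \<bullet> (u - x) + (mu + L) / L / 2 * (norm (u - x))\<^sup>2)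
      + ereal (lam / L) * h u" for u
    unfolding F_def acg_q_def linearization_def scaled_def using L lam Conv_bar_not_MInfty[OF h, of u]
    by (cases "h u") (auto simp: field_simps)
  have G: "G u = \<psi>s x / L + (grad \<psi>s x /\<^sub>R L) \<bullet> (u - x) + (mu + L) / L / 2 * (norm (u - x))\<^sup>2
      + lam / L * real_of_ereal (h u)" for u
    unfolding G_def Q_def linearization_def using L by (simp add: field_simps)
  have p: "prox_point x = (ARG_MIN F u. True)"
    unfolding prox_point_def F_def ..
  have *: "lam / L > 0" "(mu + L) / L > 0"
    using L mu lam by auto
  show "prox_point x \<in> Z"
    unfolding p by (rule quadratic_plus_argmin(1)[OF h * F G])
  show "Q x (prox_point x) + L * ((x - prox_point x) \<bullet> (u - prox_point x))
      + mu / 2 * (norm (u - prox_point x))\<^sup>2 \<le> Q x u" if "u \<in> Z"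
  proof -
    have "G (prox_point x) + (mu + L) / L / 2 * (norm (u - prox_point x))\<^sup>2 \<le> G u"
      unfolding p by (rule quadratic_plus_argmin(2)[OF h * F G that])
    then have "L * (G (prox_point x) + (mu + L) / L / 2 * (norm (u - prox_point x))\<^sup>2) \<le> L * G u"
      using L by simp
    moreover have "L * G v = Q x v + L / 2 * (norm (v - x))\<^sup>2" for v
      unfolding G_def using L by (simp add: field_simps)
    ultimately have "Q x (prox_point x) + L / 2 * (norm (prox_point x - x))\<^sup>2
        + (mu + L) / 2 * (norm (u - prox_point x))\<^sup>2 \<le> Q x u + L / 2 * (norm (u - x))\<^sup>2"
      using L by (simp add: distrib_left)
    then show ?thesis
      unfolding norm_diff_squared_expand[of u x "prox_point x"]
      by (simp add: algebra_simps add_divide_distrib inner_diff_left inner_diff_right inner_commute)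
  qed
qed

text \<open>All values are multiplied by \<open>A\<close>, so that the start \<open>A = 0\<close> is
  covered. The equation says that \<open>A * \<Gamma>\<close> plus half the squared distance to
  \<open>y0\<close> is a quadratic of modulus \<open>1 + mu * A\<close> with minimizer
  \<open>x\<close>; the last clause bounds \<open>A * \<psi> y\<close> by its minimum.\<close>

definition acg_invariant :: "'a acg_state \<Rightarrow> bool" where
  "acg_invariant s \<longleftrightarrow> (case s of (A, y, x, \<Gamma>) \<Rightarrow>
     0 \<le> A \<and> y \<in> Z \<and> (\<forall>u\<in>Z. A * \<Gamma> u \<le> A * \<psi> u) \<and>
     (\<forall>u. A * \<Gamma> u + 1 / 2 * (norm (u - y0))\<^sup>2
       = A * \<Gamma> x + 1 / 2 * (norm (x - y0))\<^sup>2 + (1 + mu * A) / 2 * (norm (u - x))\<^sup>2) \<and>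
     A * \<psi> y \<le> A * \<Gamma> x + 1 / 2 * (norm (x - y0))\<^sup>2)"

lemma Q_le_\<psi>: "regular_at x \<Longrightarrow> u \<in> Z \<Longrightarrow> Q x u \<le> \<psi> u"
  unfolding regular_at_def Q_def \<psi>_def by fastforce

lemma \<psi>_le_Q: "regular_at x \<Longrightarrow> u \<in> Z \<Longrightarrow> \<psi> u \<le> Q x u + L / 2 * (norm (u - x))\<^sup>2"
  unfolding regular_at_def Q_def \<psi>_def using mu
  by (smt (verit) divide_nonneg_pos mult_nonneg_nonneg zero_le_power2)

lemma acg_invariant_step:
  assumes inv: "acg_invariant s" and reg: "regular_at (acg_point mu L s)"
  shows "acg_invariant (acg_step \<psi>s (scaled lam h) mu L s)"
proof -
  obtain A y x \<Gamma> where s: "s = (A, y, x, \<Gamma>)"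
    by (cases s) auto
  define a where "a = acg_a mu L A"
  define A' where "A' = A + a"
  define xt where "xt = (A / A') *\<^sub>R y + (a / A') *\<^sub>R x"
  define y' where "y' = prox_point xt"
  define x' where "x' = x + (a / (1 + mu * A')) *\<^sub>R (L *\<^sub>R (y' - xt) + mu *\<^sub>R (y' - x))"
  define \<gamma> where "\<gamma> = (\<lambda>u. Q xt y' + L * ((xt - y') \<bullet> (u - y')) + mu / 2 * (norm (u - y'))\<^sup>2)"
  define \<Gamma>' where "\<Gamma>' = (\<lambda>u. A / A' * \<Gamma> u + a / A' * \<gamma> u)"
  have A: "A \<ge> 0" and y: "y \<in> Z" and below: "\<And>u. u \<in> Z \<Longrightarrow> A * \<Gamma> u \<le> A * \<psi> u"
    and quad: "\<And>u. A * \<Gamma> u + 1 / 2 * (norm (u - y0))\<^sup>2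
       = A * \<Gamma> x + 1 / 2 * (norm (x - y0))\<^sup>2 + (1 + mu * A) / 2 * (norm (u - x))\<^sup>2"
    and val: "A * \<psi> y \<le> A * \<Gamma> x + 1 / 2 * (norm (x - y0))\<^sup>2"
    using inv unfolding acg_invariant_def s prod.case by blast+
  have a: "a > 0" "L * a\<^sup>2 = (1 + mu * A) * A'"
    unfolding A'_def a_def using acg_a_pos[OF mu L A] acg_a_squared[OF mu L A] by auto
  have A': "A' > 0" "A' = A + a"
    using A a by (auto simp: A'_def)
  have reg: "regular_at xt"
    using reg unfolding s acg_point_def xt_def A'_def a_def by (simp add: Let_def)
  have y': "y' \<in> Z"
    unfolding y'_def by (rule prox_point)
  have \<gamma>_le: "\<gamma> u \<le> \<psi> u" if "u \<in> Z" for u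
    using prox_point(2)[OF that, of xt] Q_le_\<psi>[OF reg that] unfolding \<gamma>_def y'_def by simp
  have step: "acg_step \<psi>s (scaled lam h) mu L s = (A', y', x', \<Gamma>')"
    unfolding acg_step_def s prod.case Let_def acg_point_def
    unfolding a_def[symmetric] unfolding A'_def[symmetric] unfolding xt_def[symmetric]
    unfolding prox_point_def[symmetric] unfolding y'_def[symmetric] acg_q_eq[OF y'] x'_def \<Gamma>'_def \<gamma>_def
    by simp
  have \<Gamma>'_eq: "A' * \<Gamma>' u = A * \<Gamma> u + a * \<gamma> u" for u
    unfolding \<Gamma>'_def using A'(1) by (simp add: distrib_left)
  have below': "A' * \<Gamma>' u \<le> A' * \<psi> u" if "u \<in> Z" for u
  proof -
    have "a * \<gamma> u \<le> a * \<psi> u"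
      using \<gamma>_le[OF that] a by simp
    then show ?thesis
      unfolding \<Gamma>'_eq unfolding A'(2) distrib_right using below[OF that] by linarith
  qed
  have quad': "A' * \<Gamma>' u + 1 / 2 * (norm (u - y0))\<^sup>2
       = A' * \<Gamma>' x' + 1 / 2 * (norm (x' - y0))\<^sup>2 + (1 + mu * A') / 2 * (norm (u - x'))\<^sup>2" for u
  proof -
    have "1 + mu * A' > 0"
      using mu A' by (simp add: add_pos_pos)
    then have "(1 + mu * A') *\<^sub>R (x' - x) = a *\<^sub>R (L *\<^sub>R (y' - xt) + mu *\<^sub>R (y' - x))"
      unfolding x'_def by simp
    moreover have "(1 + mu * A) *\<^sub>R (x' - x) + (a * L) *\<^sub>R (xt - y') + (a * mu) *\<^sub>R (x' - y')
        = (1 + mu * A') *\<^sub>R (x' - x) - a *\<^sub>R (L *\<^sub>R (y' - xt) + mu *\<^sub>R (y' - x))"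
      unfolding A'(2) by (simp add: algebra_simps)
    ultimately have "((1 + mu * A) *\<^sub>R (x' - x) + (a * L) *\<^sub>R (xt - y') + (a * mu) *\<^sub>R (x' - y')) \<bullet> (u - x') = 0"
      by simp
    \<comment> \<open>Stationarity of the new estimate function: after expansion around
      \<open>x'\<close> these are all the terms linear in \<open>u - x'\<close>.\<close>
    then have lin: "(1 + mu * A) * ((x' - x) \<bullet> (u - x')) + a * L * ((xt - y') \<bullet> (u - x'))
        + a * mu * ((x' - y') \<bullet> (u - x')) = 0"
      by (simp add: inner_add_left)
    have d: "(xt - y') \<bullet> (u - y') = (xt - y') \<bullet> (u - x') + (xt - y') \<bullet> (x' - y')"
      by (simp add: inner_diff_right)
    show ?thesis
      unfolding \<Gamma>'_eq \<gamma>_def d using quad[of u] quad[of x'] lin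
      unfolding norm_diff_squared_expand[of u x x'] norm_diff_squared_expand[of u y' x'] A'(2)
      by (simp add: field_simps)
  qed
  have val': "A' * \<psi> y' \<le> A' * \<Gamma>' x' + 1 / 2 * (norm (x' - y0))\<^sup>2"
  proof -
    \<comment> \<open>The query with \<open>x\<close> replaced by \<open>x'\<close>. Then
      \<open>w - xt\<close> is \<open>a / A'\<close> times \<open>x' - x\<close>, and
      \<open>L * a\<^sup>2 = (1 + mu * A) * A'\<close> turns the smoothness term at \<open>w\<close>
      into the curvature term of the old estimate function at \<open>x'\<close>.\<close>
    define w where "w = (1 - a / A') *\<^sub>R y + (a / A') *\<^sub>R x'"
    have t: "1 - a / A' = A / A'" "0 \<le> a / A'" "a / A' \<le> 1"
      using A' a A by (auto simp: field_simps)
    have "w - xt = (a / A') *\<^sub>R (x' - x)"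
      unfolding w_def xt_def t by (simp add: algebra_simps)
    then have "norm (w - xt) = a / A' * norm (x' - x)"
      using A'(1) a by simp
    then have "L / 2 * (norm (w - xt))\<^sup>2 * A' = L * a\<^sup>2 * (norm (x' - x))\<^sup>2 / (2 * A')"
      using A'(1) by (simp add: power_divide power_mult_distrib power2_eq_square)
    then have nw: "L / 2 * (norm (w - xt))\<^sup>2 * A' = (1 + mu * A) / 2 * (norm (x' - x))\<^sup>2"
      unfolding a(2) using A'(1) by simp
    \<comment> \<open>Convexity of \<open>\<gamma>\<close> on the segment from \<open>y\<close> to
      \<open>x'\<close>.\<close>
    have \<gamma>w: "A' * \<gamma> w \<le> A * \<gamma> y + a * \<gamma> x'"
    proof -
      have "(norm (w - y'))\<^sup>2 \<le> (A / A') * (norm (y - y'))\<^sup>2 + a / A' * (norm (x' - y'))\<^sup>2"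
        unfolding w_def norm_convex_combination_squared unfolding t(1)
        using A A'(1) a by simp
      then have "A' * (norm (w - y'))\<^sup>2 \<le> A * (norm (y - y'))\<^sup>2 + a * (norm (x' - y'))\<^sup>2"
        using A'(1) by (simp add: field_simps)
      then have n: "mu / 2 * (A' * (norm (w - y'))\<^sup>2) \<le> mu / 2 * (A * (norm (y - y'))\<^sup>2 + a * (norm (x' - y'))\<^sup>2)"
        using mu by simp
      have "A' *\<^sub>R (w - y') = A *\<^sub>R (y - y') + a *\<^sub>R (x' - y')"
        unfolding w_def t(1) using A'(1) by (simp add: scaleR_add_right scaleR_diff_right) (simp add: A'(2) algebra_simps)
      then have "A' * ((xt - y') \<bullet> (w - y')) = A * ((xt - y') \<bullet> (y - y')) + a * ((xt - y') \<bullet> (x' - y'))"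
        by (metis inner_add_right inner_scaleR_right)
      then have "L * (A' * ((xt - y') \<bullet> (w - y'))) = L * (A * ((xt - y') \<bullet> (y - y')) + a * ((xt - y') \<bullet> (x' - y')))"
        by simp
      with n show ?thesis
        unfolding \<gamma>_def by (simp add: algebra_simps add_divide_distrib A'(2))
    qed
    have "\<psi> y' \<le> Q xt y' + L / 2 * (norm (y' - xt))\<^sup>2"
      by (rule \<psi>_le_Q[OF reg y'])
    \<comment> \<open>The sum of \<open>\<gamma>\<close> and \<open>L / 2\<close> times the squared
      distance to \<open>xt\<close> is minimal at \<open>y'\<close>, where \<open>\<gamma>\<close>
      equals \<open>Q xt y'\<close>.\<close>
    also have "\<dots> \<le> \<gamma> w + L / 2 * (norm (w - xt))\<^sup>2"
    proof -
      have "0 \<le> L / 2 * (norm (w - y'))\<^sup>2 + mu / 2 * (norm (w - y'))\<^sup>2"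
        using L mu by simp
      then show ?thesis
        unfolding \<gamma>_def norm_diff_squared_expand[of w xt y']
        by (simp add: algebra_simps inner_diff_left)
    qed
    finally have "A' * \<psi> y' \<le> A' * (\<gamma> w + L / 2 * (norm (w - xt))\<^sup>2)"
      using A'(1) by simp
    also have "\<dots> = A' * \<gamma> w + (1 + mu * A) / 2 * (norm (x' - x))\<^sup>2"
      unfolding nw[symmetric] by (simp add: algebra_simps)
    also have "\<dots> \<le> A * \<psi> y + a * \<gamma> x' + (1 + mu * A) / 2 * (norm (x' - x))\<^sup>2"
      using \<gamma>w mult_left_mono[OF \<gamma>_le[OF y] A] by simp
    \<comment> \<open>The invariant of the old state, with its quadratic evaluated at
      \<open>x'\<close>, pays for the curvature term.\<close>
    also have "\<dots> \<le> A * \<Gamma> x' + 1 / 2 * (norm (x' - y0))\<^sup>2 + a * \<gamma> x'"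
      using val quad[of x'] by simp
    finally show ?thesis
      unfolding \<Gamma>'_eq by simp
  qed
  show ?thesis
    unfolding step acg_invariant_def prod.case using A' y' below' quad' val' by (blast intro: less_imp_le)
qed

lemma acg_invariant_state: "regular_until k \<Longrightarrow> acg_invariant (state k)"
proof (induction k)
  case 0
  then show ?case
    using y0 by (simp add: acg_invariant_def)
next
  case (Suc k)
  then show ?case
    unfolding acg.simps by (intro acg_invariant_step Suc.IH) (auto simp: regular_until_def)
qed

end

section \<open>Error bounds and stopping tests of the inner runs\<close>

lemma first_from_exists_le:
  assumes "P K" "n \<le> K"
  shows "\<exists>k\<le>K. first_from n P k"
proof -
  define k where "k = (LEAST k. n \<le> k \<and> P k)"
  have "n \<le> k \<and> P k" "k \<le> K"
    unfolding k_def using assms by (auto intro: LeastI2_ex Least_le LeastI[of _ K])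
  moreover have "\<not> P j" if "n \<le> j" "j < k" for j
    using not_less_Least[of j "\<lambda>k. n \<le> k \<and> P k"] that unfolding k_def by auto
  ultimately show ?thesis
    unfolding first_from_def by blast
qed

context acg_problem
begin

lemma acg_A_pos:
  assumes "k \<ge> 1"
  shows "acg_A \<psi>s (scaled lam h) y0 mu L k > 0"
proof -
  obtain j where "k = Suc j"
    using assms by (cases k) auto
  then show ?thesis
    unfolding \<open>k = Suc j\<close> acg_A_Suc using acg_A_nonneg[OF mu L] acg_a_pos[OF mu L acg_A_nonneg[OF mu L]]
    by (meson add_nonneg_pos)
qed

text \<open>The value clause of the invariant bounds \<open>2 * A * \<eta>\<close> plus the squared
  distance of \<open>y\<close> and \<open>x\<close> by the squared distance of \<open>y0\<close> and
  \<open>y\<close>. As \<open>\<eta> \<ge> 0\<close>, by the subgradient inequality at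
  \<open>y\<close> itself, each summand is bounded alone; the second one controls \<open>r\<close>
  through the triangle inequality.\<close>

lemma acg_output_properties:
  assumes reg: "regular_until k" and k: "k \<ge> 1" and out: "out k = (y, r, \<eta>)"
  defines "A \<equiv> acg_A \<psi>s (scaled lam h) y0 mu L k"
  shows "y \<in> Z"
    and "norm r \<le> 2 / A * norm (y0 - y)"
    and "2 * A * \<eta> \<le> (norm (y0 - y))\<^sup>2"
    and "u \<in> Z \<Longrightarrow> \<psi> y + r \<bullet> (u - y) - \<eta> \<le> \<psi> u"
    and "u \<in> Z \<Longrightarrow> A * \<psi> y \<le> A * \<psi> u + 1 / 2 * (norm (u - y0))\<^sup>2"
proof -
  obtain x \<Gamma> y1 where s: "state k = (A, y1, x, \<Gamma>)"
    unfolding A_def by (cases "state k") auto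
  have A: "A > 0"
    unfolding A_def by (rule acg_A_pos[OF k])
  have y1: "y1 \<in> Z" and below: "\<And>u. u \<in> Z \<Longrightarrow> A * \<Gamma> u \<le> A * \<psi> u"
    and quad: "\<And>u. A * \<Gamma> u + 1 / 2 * (norm (u - y0))\<^sup>2
       = A * \<Gamma> x + 1 / 2 * (norm (x - y0))\<^sup>2 + (1 + mu * A) / 2 * (norm (u - x))\<^sup>2"
    and val: "A * \<psi> y1 \<le> A * \<Gamma> x + 1 / 2 * (norm (x - y0))\<^sup>2"
    using acg_invariant_state[OF reg] unfolding acg_invariant_def s prod.case by blast+
  have "real_of_ereal (composite \<psi>s (scaled lam h) y1) = \<psi> y1"
    unfolding composite_def scaled_def \<psi>_def by (subst Conv_bar_inside[OF h y1]) simp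
  then have y: "y1 = y" and r: "r = (1 / A) *\<^sub>R (y0 - x)" and \<eta>: "\<eta> = \<psi> y - \<Gamma> x - r \<bullet> (y - x)"
    using out unfolding acg_output_def s by (auto simp: Let_def)
  have Ar: "A * (r \<bullet> v) = (y0 - x) \<bullet> v" for v
    unfolding r using A by simp
  show "y \<in> Z"
    using y1 y by simp
  have "A * \<eta> = A * \<psi> y - A * \<Gamma> x - (y0 - x) \<bullet> (y - x)"
    unfolding \<eta> right_diff_distrib Ar ..
  also have "\<dots> \<le> 1 / 2 * (norm (x - y0))\<^sup>2 - (y0 - x) \<bullet> (y - x)"
    using val unfolding y by simp
  finally have \<eta>_le: "2 * A * \<eta> + (norm (y - x))\<^sup>2 \<le> (norm (y0 - y))\<^sup>2"
    using norm_diff_squared_expand[of y y0 x]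
    by (simp add: norm_minus_commute inner_diff_left)
  have sub: "\<psi> y + r \<bullet> (u - y) - \<eta> \<le> \<psi> u" if "u \<in> Z" for u
  proof -
    have "0 \<le> mu * A * (norm (u - x))\<^sup>2"
      using mu A by simp
    then have "A * \<Gamma> x + (y0 - x) \<bullet> (u - x) \<le> A * \<Gamma> u"
      using quad[of u] norm_diff_squared_expand[of u y0 x]
      by (simp add: inner_diff_left algebra_simps add_divide_distrib)
    also have "\<dots> \<le> A * \<psi> u"
      by (rule below[OF that])
    finally have "A * (\<Gamma> x + r \<bullet> (u - x)) \<le> A * \<psi> u"
      unfolding distrib_left Ar .
    then have "\<Gamma> x + r \<bullet> (u - x) \<le> \<psi> u"
      using A by simp
    then show ?thesis
      unfolding \<eta> by (simp add: inner_diff_right)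
  qed
  then show "u \<in> Z \<Longrightarrow> \<psi> y + r \<bullet> (u - y) - \<eta> \<le> \<psi> u" .
  have "0 \<le> \<eta>"
    using sub[of y] \<open>y \<in> Z\<close> by simp
  then have "0 \<le> 2 * A * \<eta>"
    using A by simp
  then show "2 * A * \<eta> \<le> (norm (y0 - y))\<^sup>2"
    using \<eta>_le by (smt (verit) zero_le_power2)
  have "(norm (y - x))\<^sup>2 \<le> (norm (y0 - y))\<^sup>2"
    using \<eta>_le \<open>0 \<le> 2 * A * \<eta>\<close> by linarith
  then have "norm (y - x) \<le> norm (y0 - y)"
    by (rule power2_le_imp_le) simp
  then have "norm (y0 - x) \<le> 2 * norm (y0 - y)"
    using norm_triangle_ineq[of "y0 - y" "y - x"] by simp
  then show "norm r \<le> 2 / A * norm (y0 - y)"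
    unfolding r norm_scaleR using A by (simp add: field_simps)
  show "A * \<psi> y \<le> A * \<psi> u + 1 / 2 * (norm (u - y0))\<^sup>2" if "u \<in> Z"
  proof -
    have "0 \<le> (1 + mu * A) / 2 * (norm (u - x))\<^sup>2"
      using mult_pos_pos[OF mu A] by (intro mult_nonneg_nonneg) simp_all
    then show ?thesis
      using val quad[of u] below[OF that] unfolding y by linarith
  qed
qed

text \<open>\<open>A \<ge> 8\<close> makes \<open>r\<close> at most a quarter as long as
  \<open>y0 - y\<close>.\<close>

lemma acg_residual_bounds:
  assumes reg: "regular_until k" and k: "k \<ge> 1" and out: "out k = (y, r, \<eta>)"
    and A: "acg_A \<psi>s (scaled lam h) y0 mu L k \<ge> 8"
  shows "3 / 4 * norm (y0 - y) \<le> norm (y0 - y + r)" "norm (y0 - y + r) \<le> 5 / 4 * norm (y0 - y)"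
proof -
  have "norm r \<le> 2 / acg_A \<psi>s (scaled lam h) y0 mu L k * norm (y0 - y)"
    by (rule acg_output_properties[OF reg k out])
  also have "\<dots> \<le> 2 / 8 * norm (y0 - y)"
    using A by (intro mult_right_mono divide_left_mono) auto
  finally have "norm r \<le> 1 / 4 * norm (y0 - y)"
    by simp
  then show "3 / 4 * norm (y0 - y) \<le> norm (y0 - y + r)" "norm (y0 - y + r) \<le> 5 / 4 * norm (y0 - y)"
    using norm_triangle_ineq[of "y0 - y" r] norm_triangle_ineq2[of "y0 - y" "- r"] by auto
qed

text \<open>With \<open>D = norm (y0 - y)\<close>, the left side of the test is at most
  \<open>3 / 2 * (D\<^sup>2 / A)\<close>, hence at most \<open>\<sigma> * D\<^sup>2 / 6\<close>,
  while the right side is at least \<open>9 / 16 * \<sigma> * D\<^sup>2\<close>.\<close>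

lemma acg_relative_test_holds:
  assumes reg: "regular_until k" and k: "k \<ge> 1" and "\<sigma> > 0"
    and A: "acg_A \<psi>s (scaled lam h) y0 mu L k \<ge> 8" "acg_A \<psi>s (scaled lam h) y0 mu L k \<ge> 9 / \<sigma>"
  shows "acg_relative_test \<psi>s (scaled lam h) y0 mu L \<sigma> k"
proof -
  obtain y r \<eta> where out: "out k = (y, r, \<eta>)"
    by (cases "out k") auto
  let ?A = "acg_A \<psi>s (scaled lam h) y0 mu L k" and ?D = "norm (y0 - y)"
  have D: "norm r \<le> 2 / ?A * ?D" "2 * ?A * \<eta> \<le> ?D\<^sup>2"
    using acg_output_properties(2,3)[OF reg k out] .
  have "(norm r)\<^sup>2 \<le> (2 / ?A * ?D)\<^sup>2"
    using D(1) by (intro power_mono) auto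
  also have "\<dots> = 4 / ?A * (?D\<^sup>2 / ?A)"
    by (simp add: power2_eq_square)
  also have "\<dots> \<le> 1 / 2 * (?D\<^sup>2 / ?A)"
    using A by (intro mult_right_mono) (auto simp: field_simps)
  finally have "(norm r)\<^sup>2 \<le> 1 / 2 * (?D\<^sup>2 / ?A)" .
  moreover have "2 * \<eta> \<le> ?D\<^sup>2 / ?A"
    using D(2) A by (simp add: field_simps)
  moreover have "?D\<^sup>2 / ?A \<le> ?D\<^sup>2 / (9 / \<sigma>)"
    using A \<open>\<sigma> > 0\<close> by (intro divide_left_mono mult_pos_pos) auto
  moreover have "\<sigma> * (3 / 4 * ?D)\<^sup>2 \<le> \<sigma> * (norm (y0 - y + r))\<^sup>2"
    using acg_residual_bounds(1)[OF reg k out A(1)] \<open>\<sigma> > 0\<close> by (intro mult_left_mono power_mono) auto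
  moreover have "\<sigma> * (3 / 4 * ?D)\<^sup>2 = 9 / 16 * (\<sigma> * ?D\<^sup>2)" "?D\<^sup>2 / (9 / \<sigma>) = (\<sigma> * ?D\<^sup>2) / 9" "0 \<le> \<sigma> * ?D\<^sup>2"
    using \<open>\<sigma> > 0\<close> by (auto simp: power2_eq_square)
  ultimately show ?thesis
    unfolding acg_relative_test_def out prod.case by linarith
qed

text \<open>Both outputs nearly minimize \<open>\<psi>\<close>, so comparing them with their midpoint shows that they
  are close to each other relative to their distance from the prox centre.\<close>
lemma acg_outputs_comparable:
  assumes sc: "strongly_convex_on Z mu \<psi>"
    and "regular_until k1" "k1 \<ge> 1" "out k1 = (y1, r1, \<eta>1)" and A1: "acg_A \<psi>s (scaled lam h) y0 mu L k1 \<ge> 9 / mu"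
    and "regular_until k2" "k2 \<ge> 1" "out k2 = (y2, r2, \<eta>2)" and A2: "acg_A \<psi>s (scaled lam h) y0 mu L k2 \<ge> 9 / mu"
  shows "norm (y0 - y2) \<le> 2 * norm (y0 - y1)"
proof -
  define c where "c = (1 - 1 / 2) *\<^sub>R y1 + (1 / 2 :: real) *\<^sub>R y2"
  have y: "y1 \<in> Z" "y2 \<in> Z"
    using acg_output_properties(1) assms by blast+
  have c: "c \<in> Z"
    unfolding c_def using y by (intro convexD[OF Conv_bar_convex[OF h]]) auto
  \<comment> \<open>The factor \<open>mu / 18\<close> bounds \<open>1 / (2 * A)\<close> for
    \<open>A \<ge> 9 / mu\<close>.\<close>
  have gap: "\<psi> y \<le> \<psi> c + mu / 18 * (norm (c - y0))\<^sup>2"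
    if "regular_until k" "k \<ge> 1" "out k = (y, r, \<eta>)" "acg_A \<psi>s (scaled lam h) y0 mu L k \<ge> 9 / mu" for k y r \<eta>
  proof -
    let ?A = "acg_A \<psi>s (scaled lam h) y0 mu L k"
    have A: "?A > 0"
      by (rule acg_A_pos[OF that(2)])
    have "?A * \<psi> y \<le> ?A * \<psi> c + 1 / 2 * (norm (c - y0))\<^sup>2"
      by (rule acg_output_properties(5)[OF that(1-3) c])
    then have "\<psi> y \<le> \<psi> c + (1 / 2 * (norm (c - y0))\<^sup>2) / ?A"
      using A by (simp add: field_simps)
    also have "(1 / 2 * (norm (c - y0))\<^sup>2) / ?A \<le> (1 / 2 * (norm (c - y0))\<^sup>2) / (9 / mu)"
      using that(4) mu A by (intro divide_left_mono mult_pos_pos) auto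
    finally show ?thesis
      by (simp add: mult.commute)
  qed
  \<comment> \<open>Added to the two gap bounds, this gives
    \<open>norm (y1 - y2) \<le> 2 / 3 * norm (c - y0)\<close>, which is at most a third of the
    summed distances of \<open>y1\<close> and \<open>y2\<close> from \<open>y0\<close>. The triangle
    inequality then yields the factor 2.\<close>
  have "\<psi> c \<le> (1 - 1 / 2) * \<psi> y1 + 1 / 2 * \<psi> y2 - mu / 2 * (1 / 2 * (1 - 1 / 2)) * (norm (y1 - y2))\<^sup>2"
    unfolding c_def using y by (intro strongly_convex_onD[OF sc]) auto
  moreover have "\<psi> y1 \<le> \<psi> c + mu / 18 * (norm (c - y0))\<^sup>2"
    using gap assms by blast
  moreover have "\<psi> y2 \<le> \<psi> c + mu / 18 * (norm (c - y0))\<^sup>2"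
    using gap assms by blast
  ultimately have "mu * (norm (y1 - y2))\<^sup>2 \<le> mu * (4 / 9 * (norm (c - y0))\<^sup>2)"
    by simp
  then have "(norm (y1 - y2))\<^sup>2 \<le> (2 / 3 * norm (c - y0))\<^sup>2"
    using mu by (simp add: power_mult_distrib power_divide)
  then have "norm (y1 - y2) \<le> 2 / 3 * norm (c - y0)"
    by (rule power2_le_imp_le) simp
  also have "c - y0 = (1 / 2) *\<^sub>R (y1 - y0) + (1 / 2) *\<^sub>R (y2 - y0)"
    unfolding c_def by (simp add: algebra_simps flip: scaleR_add_left)
  also have "norm \<dots> \<le> 1 / 2 * norm (y1 - y0) + 1 / 2 * norm (y2 - y0)"
    by (rule order_trans[OF norm_triangle_ineq]) simp
  finally have "norm (y1 - y2) \<le> 1 / 3 * (norm (y0 - y1) + norm (y0 - y2))"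
    by (simp add: norm_minus_commute)
  then show ?thesis
    using norm_triangle_ineq[of "y0 - y1" "y1 - y2"] by simp
qed

text \<open>Resolves a circularity: a query is known to be regular only while the run has not
  stopped, but the stopping bound uses regular queries. Either the run stops before
  \<open>K\<close>, or all queries before \<open>K\<close> are regular and the test succeeds at
  \<open>K\<close>.\<close>

lemma first_from_regular:
  assumes reg: "\<And>k. (\<And>j. j \<le> k \<Longrightarrow> \<not> first_from n P j) \<Longrightarrow> regular_at (acg_point mu L (state k))"
    and P: "regular_until K \<Longrightarrow> P K" and "n \<le> K"
  obtains k where "first_from n P k" "regular_until k" "k \<le> K"
proof -
  obtain k where k: "first_from n P k" "k \<le> K"
  proof (cases "\<exists>j<K. first_from n P j")
    case True
    then show ?thesis
      using that less_imp_le by blast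
  next
    case False
    then have "regular_until K"
      unfolding regular_until_def using reg by (meson le_less_trans)
    from first_from_exists_le[of P K n, OF P[OF this] \<open>n \<le> K\<close>] show ?thesis
      using that by blast
  qed
  moreover have "\<not> first_from n P j" if "j < k" for j
    using k(1) that unfolding first_from_def by blast
  then have "regular_until k"
    unfolding regular_until_def using reg by (meson le_less_trans)
  ultimately show thesis
    using that by blast
qed

text \<open>The factor 6 turns the quadratic growth \<open>K\<^sup>2 / (4 * L)\<close> into
  \<open>9 / min \<sigma> mu\<close>, which dominates all three thresholds because the minimum is
  below 1.\<close>

lemma acg_A_large:
  assumes "0 < \<sigma>" "\<sigma> < 1"
  defines "K \<equiv> nat \<lceil>6 * sqrt (L / min \<sigma> mu)\<rceil>"
  shows "K \<ge> 1" and "K \<le> k \<Longrightarrow> acg_A \<psi>s (scaled lam h) y0 mu L k \<ge> 8"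
    and "K \<le> k \<Longrightarrow> acg_A \<psi>s (scaled lam h) y0 mu L k \<ge> 9 / \<sigma>"
    and "K \<le> k \<Longrightarrow> acg_A \<psi>s (scaled lam h) y0 mu L k \<ge> 9 / mu"
proof -
  let ?m = "min \<sigma> mu" and ?A = "acg_A \<psi>s (scaled lam h) y0 mu L"
  have m: "?m > 0" "?m < 1"
    using assms mu by auto
  have s: "sqrt (L / ?m) > 0"
    using L m by simp
  then show "K \<ge> 1"
    unfolding K_def by (simp add: Suc_le_eq)
  have K: "6 * sqrt (L / ?m) \<le> real K"
    unfolding K_def by (rule real_nat_ceiling_ge)
  then have "(6 * sqrt (L / ?m))\<^sup>2 / (4 * L) \<le> (real K)\<^sup>2 / (4 * L)"
    using L s by (intro divide_right_mono power_mono) auto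
  also have "\<dots> \<le> ?A K"
    by (rule acg_A_quadratic_growth[OF mu L])
  also have "(6 * sqrt (L / ?m))\<^sup>2 / (4 * L) = 9 / ?m"
    using L m by (simp add: power_mult_distrib)
  finally have *: "9 / ?m \<le> ?A k" if "K \<le> k" for k
    using acg_A_mono[OF mu L that, of \<psi>s "scaled lam h" y0] by linarith
  have "8 \<le> 9 / ?m" "9 / \<sigma> \<le> 9 / ?m" "9 / mu \<le> 9 / ?m"
    using m assms mu by (auto simp: field_simps)
  with * show "K \<le> k \<Longrightarrow> ?A k \<ge> 8" "K \<le> k \<Longrightarrow> ?A k \<ge> 9 / \<sigma>" "K \<le> k \<Longrightarrow> ?A k \<ge> 9 / mu"
    by (meson order_trans)+
qed

lemma acg1_terminates:
  assumes \<sigma>: "0 < \<sigma>" "\<sigma> < 1"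
    and reg: "\<And>k. (\<And>j. j \<le> k \<Longrightarrow> \<not> acg1_stops_at \<psi>s (scaled lam h) y0 mu L \<sigma> j) \<Longrightarrow>
      regular_at (acg_point mu L (state k))"
  obtains k1 where "acg1_stops_at \<psi>s (scaled lam h) y0 mu L \<sigma> k1" "regular_until k1"
    "k1 \<le> nat \<lceil>6 * sqrt (L / min \<sigma> mu)\<rceil>"
proof -
  define K where "K = nat \<lceil>6 * sqrt (L / min \<sigma> mu)\<rceil>"
  define P where "P = (\<lambda>k. acg_relative_test \<psi>s (scaled lam h) y0 mu L \<sigma> k
    \<and> acg_A \<psi>s (scaled lam h) y0 mu L k \<ge> max 8 (9 / mu))"
  have stops: "acg1_stops_at \<psi>s (scaled lam h) y0 mu L \<sigma> = first_from 1 P"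
    unfolding acg1_stops_at_def P_def ..
  have K: "K \<ge> 1"
    unfolding K_def by (rule acg_A_large(1)[OF \<sigma>])
  note large = acg_A_large(2-)[OF \<sigma> order_refl, folded K_def]
  have "P K" if "regular_until K"
    unfolding P_def using acg_relative_test_holds[OF that K \<sigma>(1) large(1,2)] large by simp
  from first_from_regular[of 1 P K, OF reg[unfolded stops] this K]
  obtain k where "first_from 1 P k" "regular_until k" "k \<le> K"
    by blast
  then show thesis
    using that unfolding stops K_def by blast
qed

lemma acg1_stops_atD:
  assumes "acg1_stops_at \<psi>s (scaled lam h) y0 mu L \<sigma> k1"
  shows "k1 \<ge> 1" "acg_relative_test \<psi>s (scaled lam h) y0 mu L \<sigma> k1"
    "acg_A \<psi>s (scaled lam h) y0 mu L k1 \<ge> 8" "acg_A \<psi>s (scaled lam h) y0 mu L k1 \<ge> 9 / mu"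
  using assms unfolding acg1_stops_at_def first_from_def by auto

text \<open>\<open>B\<close> is a weight at which the error test is sure to hold: the output at
  \<open>K\<close> is within \<open>2 * C\<close> of the centre, so
  \<open>2 * A * \<eta> \<le> 4 * C\<^sup>2 \<le> 2 * B * \<eta>bar\<close>. Geometric growth
  reaches \<open>B\<close>; the ACG1 bound is added so that \<open>K\<close> is not before
  \<open>k1\<close> and the relative test holds too.\<close>

lemma acg2_terminates:
  assumes \<sigma>: "0 < \<sigma>" "\<sigma> < 1" and "mu \<le> L" and sc: "strongly_convex_on Z mu \<psi>"
    and k1: "acg1_stops_at \<psi>s (scaled lam h) y0 mu L \<sigma> k1" "regular_until k1"
      "k1 \<le> nat \<lceil>6 * sqrt (L / min \<sigma> mu)\<rceil>" "out k1 = (y1, r1, \<eta>1)"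
    and C: "norm (y0 - y1) \<le> C" "2 * C\<^sup>2 \<le> B * \<eta>bar" and B: "B > 0"
    and reg: "\<And>k. (\<And>j. j \<le> k \<Longrightarrow> \<not> acg2_stops_at \<psi>s (scaled lam h) y0 mu L \<sigma> \<eta>bar k1 j) \<Longrightarrow>
      regular_at (acg_point mu L (state k))"
  obtains k2 where "acg2_stops_at \<psi>s (scaled lam h) y0 mu L \<sigma> \<eta>bar k1 k2" "regular_until k2"
    "k2 \<le> nat \<lceil>6 * sqrt (L / min \<sigma> mu)\<rceil> + Suc (nat \<lceil>2 * sqrt (L / mu) * ln (B * L)\<rceil>)"
proof -
  define K1 where "K1 = nat \<lceil>6 * sqrt (L / min \<sigma> mu)\<rceil>"
  define K where "K = K1 + Suc (nat \<lceil>2 * sqrt (L / mu) * ln (B * L)\<rceil>)"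
  have "K1 \<le> K" "k1 \<le> K" "K \<ge> 1"
    using k1(3) unfolding K_def K1_def[symmetric] by simp_all
  have A: "acg_A \<psi>s (scaled lam h) y0 mu L K \<ge> B"
  proof -
    have "B \<le> acg_A \<psi>s (scaled lam h) y0 mu L (Suc (nat \<lceil>2 * sqrt (L / mu) * ln (B * L)\<rceil>))"
      by (rule acg_A_ge_ln[OF mu \<open>mu \<le> L\<close> B real_nat_ceiling_ge])
    also have "\<dots> \<le> acg_A \<psi>s (scaled lam h) y0 mu L K"
      by (rule acg_A_mono[OF mu L]) (simp add: K_def)
    finally show ?thesis .
  qed
  note large = acg_A_large(2-)[OF \<sigma> \<open>K1 \<le> K\<close>[unfolded K1_def]]
  define P where "P = (\<lambda>k. acg_relative_test \<psi>s (scaled lam h) y0 mu L \<sigma> k \<and> snd (snd (out k)) \<le> \<eta>bar)"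
  have stops: "acg2_stops_at \<psi>s (scaled lam h) y0 mu L \<sigma> \<eta>bar k1 = first_from k1 P"
    unfolding acg2_stops_at_def P_def ..
  have "P K" if regK: "regular_until K"
    unfolding P_def
  proof
    show "acg_relative_test \<psi>s (scaled lam h) y0 mu L \<sigma> K"
      by (rule acg_relative_test_holds[OF regK \<open>K \<ge> 1\<close> \<sigma>(1) large(1,2)])
    obtain y r \<eta> where out: "out K = (y, r, \<eta>)"
      by (cases "out K") auto
    have "norm (y0 - y) \<le> 2 * norm (y0 - y1)"
      by (rule acg_outputs_comparable[OF sc k1(2) acg1_stops_atD(1)[OF k1(1)] k1(4) acg1_stops_atD(4)[OF k1(1)]
        regK \<open>K \<ge> 1\<close> out large(3)])
    then have "norm (y0 - y) \<le> 2 * C"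
      using C(1) by linarith
    then have "(norm (y0 - y))\<^sup>2 \<le> (2 * C)\<^sup>2"
      by (rule power_mono) simp
    then have "2 * acg_A \<psi>s (scaled lam h) y0 mu L K * \<eta> \<le> 2 * (B * \<eta>bar)"
      using acg_output_properties(3)[OF regK \<open>K \<ge> 1\<close> out] C(2) by (simp add: power_mult_distrib)
    moreover have "0 \<le> B * \<eta>bar"
      using C(2) by (smt (verit) zero_le_power2)
    then have "\<eta>bar \<ge> 0"
      using B by (simp add: zero_le_mult_iff)
    then have "B * \<eta>bar \<le> acg_A \<psi>s (scaled lam h) y0 mu L K * \<eta>bar"
      using A by (intro mult_right_mono)
    ultimately have "acg_A \<psi>s (scaled lam h) y0 mu L K * \<eta> \<le> acg_A \<psi>s (scaled lam h) y0 mu L K * \<eta>bar"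
      by linarith
    then show "snd (snd (out K)) \<le> \<eta>bar"
      using large(1) by (simp add: out)
  qed
  from first_from_regular[of k1 P K, OF reg[unfolded stops] this \<open>k1 \<le> K\<close>]
  obtain k where "first_from k1 P k" "regular_until k" "k \<le> K"
    by blast
  then show thesis
    using that unfolding stops K_def K1_def by blast
qed

end

section \<open>Lipschitz continuity of the gradient\<close>

lemma gderiv_unique:
  assumes "GDERIV f z :> D" "GDERIV f z :> D'"
  shows "D = D'"
proof -
  have "(\<lambda>v. v \<bullet> D) = (\<lambda>v. v \<bullet> D')"
    using assms unfolding gderiv_def by (rule has_derivative_unique)
  then have "v \<bullet> (D - D') = 0" for v
    by (metis inner_diff_right right_minus_eq)
  then show ?thesis
    by (metis inner_eq_zero_iff right_minus_eq)
qed

lemma grad_eqI: "GDERIV f z :> D \<Longrightarrow> grad f z = D"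
  unfolding grad_def using gderiv_unique by blast

lemma curvature_class_abs:
  assumes "f \<in> curvature_class m M S" "u \<in> S" "z \<in> S"
  shows "\<bar>f u - f z - grad f z \<bullet> (u - z)\<bar> \<le> max m M / 2 * (norm (u - z))\<^sup>2"
proof -
  have "- (m / 2) * (norm (u - z))\<^sup>2 \<le> f u - f z - grad f z \<bullet> (u - z)"
    "f u - f z - grad f z \<bullet> (u - z) \<le> M / 2 * (norm (u - z))\<^sup>2"
    using assms unfolding curvature_class_def linearization_def by (auto simp: algebra_simps)
  moreover have "m / 2 * (norm (u - z))\<^sup>2 \<le> max m M / 2 * (norm (u - z))\<^sup>2"
    "M / 2 * (norm (u - z))\<^sup>2 \<le> max m M / 2 * (norm (u - z))\<^sup>2"
    by (auto intro!: mult_right_mono)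
  ultimately show ?thesis
    by linarith
qed

text \<open>The difference \<open>f a - f b\<close> over a diameter \<open>[a, b]\<close> of the ball parallel to the difference of
  the gradients is expanded both from \<open>x\<close> and from \<open>y\<close>; this yields the sharp constant.\<close>
lemma grad_lipschitz_local:
  assumes f: "f \<in> curvature_class m M S" and "x \<in> S" "y \<in> S"
    and ball: "cball ((1 / 2) *\<^sub>R (x + y)) (norm (y - x) / 2) \<subseteq> S"
  shows "norm (grad f y - grad f x) \<le> max m M * norm (y - x)"
proof (cases "grad f y = grad f x \<or> x = y")
  case True
  then show ?thesis
  proof
    assume "grad f y = grad f x"
    \<comment> \<open>The right-hand side must still be shown nonnegative; the two-sided curvature
      bound forces this when \<open>x \<noteq> y\<close>.\<close>
    have "0 \<le> max m M * (norm (y - x))\<^sup>2"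
      using curvature_class_abs[OF f \<open>y \<in> S\<close> \<open>x \<in> S\<close>] by (smt (verit) field_sum_of_halves distrib_right)
    then have "x \<noteq> y \<Longrightarrow> 0 \<le> max m M"
      by (simp add: zero_le_mult_iff)
    then show ?thesis
      using \<open>grad f y = grad f x\<close> by (cases "x = y") auto
  qed simp
next
  case False
  define G where "G = grad f y - grad f x"
  define d where "d = y - x"
  \<comment> \<open>The radius vector of the ball in the direction of the gradient difference, so
    that \<open>G \<bullet> w\<close> is half of \<open>norm d * norm G\<close>.\<close>
  define w where "w = (norm d / (2 * norm G)) *\<^sub>R G"
  define c where "c = (1 / 2) *\<^sub>R (x + y)"
  define K where "K = max m M"
  have G: "norm G > 0" and d: "norm d > 0"
    using False by (auto simp: G_def d_def)
  have nw: "norm w = norm d / 2"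
    unfolding w_def using G by simp
  have ab: "c + w \<in> S" "c - w \<in> S"
    using ball nw by (auto simp: c_def d_def subset_iff dist_norm)
  have ex: "c + w - x = (1 / 2) *\<^sub>R d + w" "c - w - x = (1 / 2) *\<^sub>R d - w"
    "c + w - y = w - (1 / 2) *\<^sub>R d" "c - w - y = - (w + (1 / 2) *\<^sub>R d)"
    unfolding c_def d_def by (simp_all add: algebra_simps flip: scaleR_add_left)
  \<comment> \<open>Parallelogram law: the squared distances from \<open>x\<close> to the two ends
    of the diameter add up to \<open>(norm d)\<^sup>2\<close>, and likewise from
    \<open>y\<close>.\<close>
  have pl: "(norm ((1 / 2) *\<^sub>R d + w))\<^sup>2 + (norm ((1 / 2) *\<^sub>R d - w))\<^sup>2 = (norm d)\<^sup>2"
  proof -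
    have "(norm ((1 / 2) *\<^sub>R d + w))\<^sup>2 + (norm ((1 / 2) *\<^sub>R d - w))\<^sup>2
      = 2 * (norm ((1 / 2) *\<^sub>R d))\<^sup>2 + 2 * (norm w)\<^sup>2"
      unfolding power2_norm_eq_inner by (simp add: inner_add_left inner_add_right inner_diff_left inner_diff_right inner_commute)
    then show ?thesis
      unfolding nw by (simp add: power_divide)
  qed
  have n: "norm (w - (1 / 2) *\<^sub>R d) = norm ((1 / 2) *\<^sub>R d - w)"
    "norm (- (w + (1 / 2) *\<^sub>R d)) = norm ((1 / 2) *\<^sub>R d + w)"
    unfolding norm_minus_cancel by (rule norm_minus_commute) (simp only: add.commute)
  note bd = curvature_class_abs[OF f, folded K_def]
  have "f (c + w) - f (c - w) \<le> grad f x \<bullet> (c + w - x) - grad f x \<bullet> (c - w - x) + K / 2 * (norm d)\<^sup>2"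
    using bd[OF ab(1) \<open>x \<in> S\<close>] bd[OF ab(2) \<open>x \<in> S\<close>]
    unfolding pl[symmetric] ex distrib_left by linarith
  moreover have "grad f y \<bullet> (c + w - y) - grad f y \<bullet> (c - w - y) - K / 2 * (norm d)\<^sup>2 \<le> f (c + w) - f (c - w)"
    using bd[OF ab(1) \<open>y \<in> S\<close>] bd[OF ab(2) \<open>y \<in> S\<close>]
    unfolding pl[symmetric] ex n distrib_left by linarith
  ultimately have "2 * (G \<bullet> w) \<le> K * (norm d)\<^sup>2"
    unfolding G_def by (simp add: inner_diff_left inner_diff_right inner_add_right)
  moreover have "2 * (G \<bullet> w) = norm d * norm G"
    unfolding w_def using G by (simp add: power2_norm_eq_inner[symmetric] power2_eq_square)
  ultimately have "norm d * norm G \<le> norm d * (K * norm d)"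
    by (simp add: power2_eq_square mult.left_commute)
  then show ?thesis
    using d unfolding G_def d_def K_def by simp
qed

text \<open>By compactness, balls of one radius \<open>e\<close> around all points of the segment
  stay in \<open>S\<close>. Cutting the segment into pieces shorter than \<open>e\<close> makes the
  local estimate apply to each, and the pieces telescope without loss.\<close>

lemma grad_lipschitz_interior:
  fixes S :: "'a::euclidean_space set"
  assumes f: "f \<in> curvature_class m M S" and S: "convex S" and x: "x \<in> interior S" and y: "y \<in> interior S"
  shows "norm (grad f y - grad f x) \<le> max m M * norm (y - x)"
proof -
  define p where "p = (\<lambda>t. x + t *\<^sub>R (y - x))"
  have "closed_segment x y \<subseteq> interior S"
    using x y S by (simp add: closed_segment_subset convex_interior)
  then obtain e where e: "e > 0" "(\<Union>z\<in>closed_segment x y. cball z e) \<subseteq> interior S"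
    using compact_subset_open_imp_cball_epsilon_subset[of "closed_segment x y" "interior S"] by auto
  have p: "cball (p t) e \<subseteq> S" "p t \<in> S" if "0 \<le> t" "t \<le> 1" for t
  proof -
    have "p t \<in> closed_segment x y"
      unfolding in_segment p_def using that by (intro exI[of _ t]) (simp add: algebra_simps)
    then show "cball (p t) e \<subseteq> S"
      using e interior_subset by blast
    then show "p t \<in> S"
      using e(1) by (meson centre_in_cball less_imp_le subset_iff)
  qed
  obtain n where n: "n > 0" "norm (y - x) / e < real n"
    by (metis gr0I less_trans of_nat_0 reals_Archimedean2 divide_nonneg_pos e(1) norm_ge_zero not_less)
  define q where "q = (\<lambda>i. p (real i / real n))"
  have step: "norm (grad f (q (Suc i)) - grad f (q i)) \<le> max m M * (norm (y - x) / n)" if "i < n" for i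
  proof -
    have d: "q (Suc i) - q i = (1 / n) *\<^sub>R (y - x)"
      unfolding q_def p_def by (simp add: add_divide_distrib algebra_simps)
    have c: "(1 / 2) *\<^sub>R (q i + q (Suc i)) = p ((real i + 1 / 2) / n)"
    proof -
      have "p s + p t = 2 *\<^sub>R p ((s + t) / 2)" for s t
      proof -
        have "2 * ((s + t) / 2) = s + t"
          by simp
        then show ?thesis
          unfolding p_def scaleR_add_right scaleR_scaleR by (simp only: scaleR_2 scaleR_add_left) simp
      qed
      then have "(1 / 2) *\<^sub>R (q i + q (Suc i)) = p ((real i / n + real (Suc i) / n) / 2)"
        unfolding q_def by simp
      also have "(real i / n + real (Suc i) / n) / 2 = (real i + 1 / 2) / n"
        using n by (simp add: field_simps)
      finally show ?thesis .
    qed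
    have "cball (p ((real i + 1 / 2) / n)) e \<subseteq> S"
      using that n by (intro p) (auto simp: field_simps)
    moreover have "norm (q (Suc i) - q i) / 2 \<le> e"
    proof -
      have "norm (y - x) / n < e"
        using n e(1) by (simp add: field_simps)
      moreover have "norm (q (Suc i) - q i) = norm (y - x) / n"
        unfolding d using n by simp
      ultimately show ?thesis
        using norm_ge_zero[of "q (Suc i) - q i"] e(1) by linarith
    qed
    ultimately have ball: "cball ((1 / 2) *\<^sub>R (q i + q (Suc i))) (norm (q (Suc i) - q i) / 2) \<subseteq> S"
      unfolding c by (meson order_trans subset_cball)
    have q: "q i \<in> S" "q (Suc i) \<in> S"
      unfolding q_def using that n by (auto intro!: p simp: field_simps)
    have "norm (grad f (q (Suc i)) - grad f (q i)) \<le> max m M * norm (q (Suc i) - q i)"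
      by (rule grad_lipschitz_local[OF f q ball])
    then show ?thesis
      unfolding d using n by simp
  qed
  have "q 0 = x" "q n = y"
    unfolding q_def p_def using n by auto
  have "norm (grad f (q n) - grad f (q 0)) = norm (\<Sum>i<n. grad f (q (Suc i)) - grad f (q i))"
    by (simp only: sum_lessThan_telescope[of "\<lambda>i. grad f (q i)"])
  also have "\<dots> \<le> (\<Sum>i<n. norm (grad f (q (Suc i)) - grad f (q i)))"
    by (rule norm_sum)
  also have "\<dots> \<le> (\<Sum>i<n. max m M * (norm (y - x) / n))"
    by (intro sum_mono step) simp
  also have "\<dots> = max m M * norm (y - x)"
    using n by simp
  finally show ?thesis
    unfolding \<open>q 0 = x\<close> \<open>q n = y\<close> .
qed

text \<open>Boundary points are reached by shrinking towards an interior point \<open>c\<close> and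
  passing to the limit, using continuity of the gradient on \<open>S\<close>.\<close>

lemma grad_lipschitz:
  fixes S :: "'a::euclidean_space set"
  assumes f: "f \<in> curvature_class m M S" and S: "convex S" "interior S \<noteq> {}" and x: "x \<in> S" and y: "y \<in> S"
  shows "norm (grad f y - grad f x) \<le> max m M * norm (y - x)"
proof -
  obtain c where c: "c \<in> interior S"
    using S by auto
  define e where "e = (\<lambda>n. 1 / real (Suc n))"
  have e: "0 < e n" "e n \<le> 1" for n
    by (auto simp: e_def)
  have in_int: "v - e n *\<^sub>R (v - c) \<in> interior S" if "v \<in> S" for v n
    by (rule mem_interior_convex_shrink[OF S(1) c that e])
  have lim: "(\<lambda>n. grad f (v - e n *\<^sub>R (v - c))) \<longlonglongrightarrow> grad f v" if "v \<in> S" for v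
  proof (rule continuous_on_tendsto_compose[of S "grad f" "\<lambda>n. v - e n *\<^sub>R (v - c)" v])
    show "continuous_on S (grad f)"
      using f unfolding curvature_class_def by auto
    have "(\<lambda>n. v - e n *\<^sub>R (v - c)) \<longlonglongrightarrow> v - 0 *\<^sub>R (v - c)"
      unfolding e_def by (intro tendsto_intros LIMSEQ_Suc lim_1_over_n)
    then show "(\<lambda>n. v - e n *\<^sub>R (v - c)) \<longlonglongrightarrow> v"
      by simp
    show "\<forall>\<^sub>F n in sequentially. v - e n *\<^sub>R (v - c) \<in> S"
      using in_int[OF that] interior_subset by (intro always_eventually) blast
  qed (fact that)
  have "(\<lambda>n. norm (grad f (y - e n *\<^sub>R (y - c)) - grad f (x - e n *\<^sub>R (x - c)))) \<longlonglongrightarrow> norm (grad f y - grad f x)"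
    by (intro tendsto_intros lim x y)
  moreover have "(\<lambda>n. max m M * norm (y - e n *\<^sub>R (y - c) - (x - e n *\<^sub>R (x - c)))) \<longlonglongrightarrow> max m M * norm (y - 0 *\<^sub>R (y - c) - (x - 0 *\<^sub>R (x - c)))"
    unfolding e_def by (intro tendsto_intros LIMSEQ_Suc lim_1_over_n)
  ultimately show ?thesis
    using grad_lipschitz_interior[OF f S(1) in_int[OF x] in_int[OF y]] x y
    by (intro LIMSEQ_le[where X = "\<lambda>n. norm (grad f (y - e n *\<^sub>R (y - c)) - grad f (x - e n *\<^sub>R (x - c)))"]) auto
qed

section \<open>The refinement step\<close>

text \<open>Testing the subgradient inequality at the minimizer \<open>y\<close> would cost a factor
  2 in front of \<open>norm v\<close>. A point between \<open>x\<close> and \<open>y\<close>, placed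
  according to the error level \<open>b\<close>, avoids this loss.\<close>

lemma strongly_convex_approximate_subgradient:
  assumes sc: "strongly_convex_on S K G" and "convex S" "K > 0" "x \<in> S" "y \<in> S"
    and y: "G y + K / 2 * (norm (x - y))\<^sup>2 \<le> G x"
    and sub: "\<And>u. u \<in> S \<Longrightarrow> G x + v \<bullet> (u - x) - e \<le> G u"
    and b: "b > 0" "2 * K * e \<le> b\<^sup>2"
  shows "K * norm (x - y) \<le> norm v + b"
proof (rule ccontr)
  define t where "t = norm (x - y)"
  assume "\<not> ?thesis"
  then have large: "K * t > norm v + b"
    by (simp add: t_def)
  then have Kt: "K * t > b"
    by (smt (verit) norm_ge_zero)
  \<comment> \<open>Chosen so that \<open>s * (K * t) = b\<close>; every term of the inequality,
    multiplied by \<open>2 * K\<close>, then carries or is bounded by a multiple of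
    \<open>b\<close>.\<close>
  define s where "s = b / (K * t)"
  have "0 < K * t"
    using Kt b by linarith
  moreover from this have "t \<noteq> 0"
    by auto
  ultimately have s: "0 < s" "s < 1" "s * (K * t) = b"
    unfolding s_def using Kt b(1) \<open>K > 0\<close> by (simp_all add: divide_less_eq)
  let ?u = "(1 - s) *\<^sub>R x + s *\<^sub>R y"
  have "G x + v \<bullet> (?u - x) - e \<le> G ?u"
    using s assms by (intro sub convexD) auto
  also have "\<dots> \<le> (1 - s) * G x + s * G y - K / 2 * (s * (1 - s)) * t\<^sup>2"
    unfolding t_def using s assms by (intro strongly_convex_onD[OF sc]) auto
  also have "v \<bullet> (?u - x) = s * (v \<bullet> (y - x))"
    by (simp add: inner_diff_right inner_add_right algebra_simps)
  finally have 1: "G x + s * (v \<bullet> (y - x)) - e \<le> (1 - s) * G x + s * G y - K / 2 * (s * (1 - s)) * t\<^sup>2" .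
  have "- (norm v * t) \<le> v \<bullet> (y - x)"
    using Cauchy_Schwarz_ineq2[of v "y - x"] by (simp add: t_def norm_minus_commute)
  then have 2: "s * (- (norm v * t)) \<le> s * (v \<bullet> (y - x))"
    using s by (intro mult_left_mono) auto
  have 3: "s * (G y + K / 2 * t\<^sup>2) \<le> s * G x"
    using y s unfolding t_def by (intro mult_left_mono) auto
  have "s * (K * t\<^sup>2) - K / 2 * (s\<^sup>2 * t\<^sup>2) \<le> s * (norm v * t) + e"
  proof -
    have "(1 - s) * G x + s * G y - K / 2 * (s * (1 - s)) * t\<^sup>2
      = G x - s * G x + s * (G y + K / 2 * t\<^sup>2) - (s * (K * t\<^sup>2) - K / 2 * (s\<^sup>2 * t\<^sup>2))"
      by (simp add: field_simps power2_eq_square)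
    then show ?thesis
      using 1 2 3 by linarith
  qed
  then have "(2 * K) * (s * (K * t\<^sup>2) - K / 2 * (s\<^sup>2 * t\<^sup>2)) \<le> (2 * K) * (s * (norm v * t) + e)"
    using \<open>K > 0\<close> by (intro mult_left_mono) auto
  then have "2 * (s * (K * t)) * (K * t) - (s * (K * t))\<^sup>2 \<le> 2 * norm v * (s * (K * t)) + 2 * K * e"
    by (simp add: algebra_simps power2_eq_square)
  then have "2 * b * (K * t) \<le> b * (2 * norm v + 2 * b)"
    unfolding s using b(2) by (simp add: algebra_simps power2_eq_square)
  then have "b * (2 * (K * t)) \<le> b * (2 * norm v + 2 * b)"
    by (simp add: algebra_simps)
  then have "K * t \<le> norm v + b"
    using b by simp
  with large show False
    by simp
qed

lemma curvature_class_lower: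
  assumes "f \<in> curvature_class m M S" "u \<in> S" "z \<in> S"
  shows "f z + grad f z \<bullet> (u - z) - m / 2 * (norm (u - z))\<^sup>2 \<le> f u"
proof -
  have "- (m / 2) * (norm (u - z))\<^sup>2 \<le> f u - linearization f z u"
    using assms unfolding curvature_class_def by blast
  then show ?thesis
    unfolding linearization_def by simp
qed

lemma curvature_class_upper:
  assumes "f \<in> curvature_class m M S" "u \<in> S" "z \<in> S"
  shows "f u \<le> f z + grad f z \<bullet> (u - z) + M / 2 * (norm (u - z))\<^sup>2"
proof -
  have "f u - linearization f z u \<le> M / 2 * (norm (u - z))\<^sup>2"
    using assms unfolding curvature_class_def by blast
  then show ?thesis
    unfolding linearization_def by simp
qed

text \<open>The minimizer of the model is within \<open>\<rho> / (2 * K)\<close> of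
  \<open>z\<close>. Both parts of the output vector, the scaled step and the gradient difference,
  are at most \<open>K\<close> times this distance.\<close>

lemma refine_point_properties:
  fixes f :: "'a::euclidean_space \<Rightarrow> real"
  assumes h: "h \<in> Conv_bar Z" and f: "f \<in> curvature_class m M S" and S: "Z \<subseteq> S" "convex S" "interior S \<noteq> {}"
    and pos: "0 < m" "0 < M" "0 < lam" "0 < \<rho>" and z: "z \<in> Z"
    and sub: "\<And>u. u \<in> Z \<Longrightarrow> lam * (f z + real_of_ereal (h z)) + w \<bullet> (u - z) - 1 / 2 * (norm (u - z))\<^sup>2 - \<eta>
      \<le> lam * (f u + real_of_ereal (h u))"
    and w: "norm w \<le> lam * \<rho> / 4" and \<eta>: "\<eta> \<le> lam * (\<rho>\<^sup>2 / (32 * (max m M + 1 / lam)))"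
  shows "refine_point f h m M lam z \<in> Z"
    and "refine_vector f h m M lam z \<in> (\<lambda>\<xi>. grad f (refine_point f h m M lam z) + \<xi>) `
      subdifferential h (refine_point f h m M lam z)"
    and "norm (refine_vector f h m M lam z) \<le> \<rho>"
proof -
  define K where "K = max m M + 1 / lam"
  define y where "y = refine_point f h m M lam z"
  define F where "F = (\<lambda>u. ereal (linearization f z u) + h u + ereal (K / 2 * (norm (u - z))\<^sup>2))"
  define G where "G = (\<lambda>u. f z + grad f z \<bullet> (u - z) + K / 2 * (norm (u - z))\<^sup>2 + 1 * real_of_ereal (h u))"
  have K: "K > 0" "max m M \<le> K" "lam * K = lam * max m M + 1"
    using pos by (auto simp: K_def add_pos_pos max_def algebra_simps)
  have yF: "y = (ARG_MIN F u. True)"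
    unfolding y_def refine_point_def F_def K_def Let_def ..
  have F: "F u = ereal (f z + grad f z \<bullet> (u - z) + K / 2 * (norm (u - z))\<^sup>2) + ereal 1 * h u" for u
    unfolding F_def linearization_def by (cases "h u") auto
  have yZ: "y \<in> Z" and ymin: "\<And>u. u \<in> Z \<Longrightarrow> G y + K / 2 * (norm (u - y))\<^sup>2 \<le> G u"
    unfolding yF using quadratic_plus_argmin[OF h zero_less_one K(1) F G_def[THEN fun_cong]] by auto
  then show "refine_point f h m M lam z \<in> Z"
    by (simp add: y_def)
  define \<xi> where "\<xi> = K *\<^sub>R (z - y) - grad f z"
  have v: "refine_vector f h m M lam z = grad f y + \<xi>"
    unfolding refine_vector_def y_def[symmetric] K_def[symmetric] Let_def \<xi>_def by simp
  have "\<xi> \<in> subdifferential h y"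
  proof -
    have "h y + ereal (\<xi> \<bullet> (u - y)) \<le> h u" for u
    proof (cases "u \<in> Z")
      case True
      \<comment> \<open>The square in the growth inequality cancels exactly against the quadratic of
        the model, leaving a true subgradient of \<open>h\<close>.\<close>
      have "real_of_ereal (h y) + \<xi> \<bullet> (u - y) \<le> real_of_ereal (h u)"
        using ymin[OF True] unfolding G_def \<xi>_def norm_diff_squared_expand[of u z y]
        by (simp add: algebra_simps inner_diff_left inner_diff_right add_divide_distrib)
      then show ?thesis
        by (subst Conv_bar_inside[OF h yZ], subst Conv_bar_inside[OF h True]) simp
    qed (simp add: Conv_bar_outside[OF h])
    moreover have "\<bar>h y\<bar> \<noteq> \<infinity>"
      by (subst Conv_bar_inside[OF h yZ]) simp
    ultimately show ?thesis
      unfolding subdifferential_def by blast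
  qed
  then show "refine_vector f h m M lam z \<in> (\<lambda>\<xi>. grad f (refine_point f h m M lam z) + \<xi>) `
      subdifferential h (refine_point f h m M lam z)"
    unfolding v y_def[symmetric] by blast
  \<comment> \<open>The upper curvature bound replaces \<open>f\<close> by its linearization, and
    \<open>lam * M + 1 \<le> lam * K\<close> absorbs the prox term: \<open>w\<close> divided by
    \<open>lam\<close> becomes an approximate subgradient of the model at \<open>z\<close>.\<close>
  have "G z + (w /\<^sub>R lam) \<bullet> (u - z) - \<eta> / lam \<le> G u" if u: "u \<in> Z" for u
  proof -
    let ?n = "(norm (u - z))\<^sup>2"
    have "f u \<le> f z + grad f z \<bullet> (u - z) + M / 2 * ?n"
      using u z S by (intro curvature_class_upper[OF f]) auto
    then have "lam * (f u + real_of_ereal (h u))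
        \<le> lam * (f z + grad f z \<bullet> (u - z) + M / 2 * ?n + real_of_ereal (h u))"
      using pos by simp
    moreover have "lam * (M / 2 * ?n) + 1 / 2 * ?n \<le> lam * (K / 2 * ?n)"
    proof -
      have "(lam * M + 1) * (?n / 2) \<le> (lam * K) * (?n / 2)"
        unfolding K(3) using pos by (intro mult_right_mono) auto
      then show ?thesis
        by (simp add: algebra_simps)
    qed
    ultimately have "lam * (f z + real_of_ereal (h z)) + w \<bullet> (u - z) - \<eta> \<le> lam * G u"
      using sub[OF u] unfolding G_def distrib_left by linarith
    moreover have "lam * (G z + (w /\<^sub>R lam) \<bullet> (u - z) - \<eta> / lam)
      = lam * (f z + real_of_ereal (h z)) + w \<bullet> (u - z) - \<eta>"
      unfolding G_def using pos by (simp add: field_simps)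
    ultimately show ?thesis
      using pos by (metis mult_le_cancel_left_pos)
  qed
  moreover have "strongly_convex_on Z K G"
    unfolding G_def by (intro strongly_convex_on_quadratic_plus[OF h]) simp
  \<comment> \<open>The 32 in the tolerance is \<open>2 * 4\<^sup>2\<close>, made for the error
    level \<open>b = \<rho> / 4\<close>.\<close>
  moreover have "2 * K * (\<eta> / lam) \<le> (\<rho> / 4)\<^sup>2"
  proof -
    have "\<eta> / lam \<le> \<rho>\<^sup>2 / (32 * K)"
      using \<eta> pos unfolding K_def[symmetric] by (simp add: field_simps)
    then have "2 * K * (\<eta> / lam) \<le> 2 * K * (\<rho>\<^sup>2 / (32 * K))"
      using K by (intro mult_left_mono) auto
    then show ?thesis
      using K by (simp add: power_divide)
  qed
  ultimately have "K * norm (z - y) \<le> norm (w /\<^sub>R lam) + \<rho> / 4"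
    using strongly_convex_approximate_subgradient[of Z K G z y "w /\<^sub>R lam" "\<eta> / lam" "\<rho> / 4"]
      Conv_bar_convex[OF h] K z yZ ymin[OF z] pos
    by simp
  also have "norm (w /\<^sub>R lam) \<le> \<rho> / 4"
    using w pos by (simp add: field_simps)
  finally have Kt: "K * norm (z - y) \<le> \<rho> / 2"
    by simp
  have "norm (grad f y - grad f z) \<le> max m M * norm (y - z)"
    using S yZ z by (intro grad_lipschitz[OF f]) auto
  also have "\<dots> \<le> K * norm (z - y)"
    unfolding norm_minus_commute[of y z] using K by (intro mult_right_mono) auto
  finally have "norm (K *\<^sub>R (z - y) + (grad f y - grad f z)) \<le> K * norm (z - y) + K * norm (z - y)"
    using K by (intro norm_triangle_mono) auto
  moreover have "refine_vector f h m M lam z = K *\<^sub>R (z - y) + (grad f y - grad f z)"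
    unfolding v \<xi>_def by simp
  ultimately show "norm (refine_vector f h m M lam z) \<le> \<rho>"
    using Kt by simp
qed

section \<open>The proximal subproblems\<close>

lemma grad_prox_smooth:
  assumes "GDERIV f x :> D"
  shows "grad (prox_smooth lam f z) x = lam *\<^sub>R D + (x - z)"
proof (rule grad_eqI)
  have "(f has_derivative (\<lambda>v. v \<bullet> D)) (at x)"
    using assms unfolding gderiv_def .
  then have "((\<lambda>u. lam * f u + 1 / 2 * ((u - z) \<bullet> (u - z))) has_derivative
      (\<lambda>v. lam * (v \<bullet> D) + 1 / 2 * ((x - z) \<bullet> v + v \<bullet> (x - z)))) (at x)"
    by (auto intro!: derivative_eq_intros)
  moreover have "(\<lambda>v. lam * (v \<bullet> D) + 1 / 2 * ((x - z) \<bullet> v + v \<bullet> (x - z))) = (\<lambda>v. v \<bullet> (lam *\<^sub>R D + (x - z)))"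
    by (auto simp: inner_add_right inner_commute)
  ultimately show "GDERIV (prox_smooth lam f z) x :> lam *\<^sub>R D + (x - z)"
    unfolding gderiv_def prox_smooth_def[abs_def] power2_norm_eq_inner by simp
qed

text \<open>Weak convexity: the lower bounds at \<open>x\<close> and \<open>y\<close>, both based at
  the combination point, are averaged and the gradient terms cancel.\<close>

lemma curvature_class_convex_combination:
  assumes f: "f \<in> curvature_class m M S" and "convex S" "x \<in> S" "y \<in> S" "0 \<le> t" "t \<le> 1"
  shows "f ((1 - t) *\<^sub>R x + t *\<^sub>R y) \<le> (1 - t) * f x + t * f y + m / 2 * (t * (1 - t)) * (norm (x - y))\<^sup>2"
proof -
  define v where "v = (1 - t) *\<^sub>R x + t *\<^sub>R y"
  have v: "v \<in> S"
    unfolding v_def using assms by (intro convexD) auto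
  have low: "f v + grad f v \<bullet> (u - v) - m / 2 * (norm (u - v))\<^sup>2 \<le> f u" if "u \<in> S" for u
    using curvature_class_lower[OF f that v] by simp
  have d: "x - v = t *\<^sub>R (x - y)" "y - v = - ((1 - t) *\<^sub>R (x - y))"
    unfolding v_def by (simp_all add: algebra_simps)
  have "(norm (x - v))\<^sup>2 = t\<^sup>2 * (norm (x - y))\<^sup>2" "(norm (y - v))\<^sup>2 = (1 - t)\<^sup>2 * (norm (x - y))\<^sup>2"
    unfolding d norm_minus_cancel by (simp_all add: power_mult_distrib)
  then have "f v + t * (grad f v \<bullet> (x - y)) - m / 2 * (t\<^sup>2 * (norm (x - y))\<^sup>2) \<le> f x"
    "f v - (1 - t) * (grad f v \<bullet> (x - y)) - m / 2 * ((1 - t)\<^sup>2 * (norm (x - y))\<^sup>2) \<le> f y"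
    using low[of x] low[of y] assms by (simp_all add: d)
  then have "(1 - t) * (f v + t * (grad f v \<bullet> (x - y)) - m / 2 * (t\<^sup>2 * (norm (x - y))\<^sup>2)) \<le> (1 - t) * f x"
    "t * (f v - (1 - t) * (grad f v \<bullet> (x - y)) - m / 2 * ((1 - t)\<^sup>2 * (norm (x - y))\<^sup>2)) \<le> t * f y"
    using assms by (auto intro!: mult_left_mono)
  moreover have "(1 - t) * (F + t * g - m / 2 * (t\<^sup>2 * n)) + t * (F - (1 - t) * g - m / 2 * ((1 - t)\<^sup>2 * n))
    = F - m / 2 * (t * (1 - t)) * n" for F g n :: real
    by (simp add: field_simps power2_eq_square)
  ultimately show ?thesis
    unfolding v_def[symmetric] by (smt (verit))
qed

section \<open>Complexity of the method\<close>

locale aipp_problem =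
  fixes Z Omega :: "'a::euclidean_space set"
    and f :: "'a \<Rightarrow> real" and h :: "'a \<Rightarrow> ereal"
    and m M \<rho> \<sigma> lam :: real and z0 :: 'a
  assumes h: "h \<in> Conv_bar Z" and m: "m > 0" and M: "M > 0"
    and Omega: "Z \<subseteq> Omega" "convex Omega" "interior Omega \<noteq> {}"
    and f: "f \<in> curvature_class m M Omega"
    and queries: "aipp_queries f h m M lam \<rho> \<sigma> z0 \<subseteq> Omega"
    and bounded_below: "(INF z. composite f h z) > -\<infinity>"
    and \<rho>: "\<rho> > 0" and \<sigma>: "0 < \<sigma>" "\<sigma> < 1" and lam: "0 < lam" "lam < 1 / m" and z0: "z0 \<in> Z"
begin

definition \<phi> :: "'a \<Rightarrow> real" where
  "\<phi> u = f u + real_of_ereal (h u)"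

definition \<phi>_inf :: real where
  "\<phi>_inf = real_of_ereal (INF z. composite f h z)"

definition mu :: real where "mu = 1 - lam * m"
definition L :: real where "L = 1 + lam * M"

definition acg1_budget :: nat where "acg1_budget = nat \<lceil>6 * sqrt (L / min \<sigma> mu)\<rceil>"
text \<open>The product in the logarithm is \<open>B * L\<close> for the target weight
  \<open>B = L\<close>.\<close>

definition acg2_budget :: nat where "acg2_budget = acg1_budget + Suc (nat \<lceil>2 * sqrt (L / mu) * ln (L * L)\<rceil>)"

lemma composite_eq: "u \<in> Z \<Longrightarrow> composite f h u = ereal (\<phi> u)"
  unfolding composite_def \<phi>_def by (subst Conv_bar_inside[OF h]) auto

lemma composite_outside: "u \<notin> Z \<Longrightarrow> composite f h u = \<infinity>"
  unfolding composite_def by (simp add: Conv_bar_outside[OF h])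

lemma INF_composite: "(INF z. composite f h z) = ereal \<phi>_inf"
proof -
  have "(INF z. composite f h z) \<le> ereal (\<phi> z0)"
    unfolding composite_eq[OF z0, symmetric] by (rule INF_lower) simp
  with bounded_below show ?thesis
    unfolding \<phi>_inf_def by (cases "INF z. composite f h z") auto
qed

lemma \<phi>_inf_le: "u \<in> Z \<Longrightarrow> \<phi>_inf \<le> \<phi> u"
  using INF_lower[of u UNIV "composite f h"] unfolding INF_composite by (simp add: composite_eq)

lemma mu: "0 < mu" "mu < 1" and L: "L > 1"
  using lam m M by (auto simp: mu_def L_def field_simps)

lemma linearization_prox_smooth:
  assumes "x \<in> Omega"
  shows "linearization (prox_smooth lam f z) x u
    = lam * (f x + grad f x \<bullet> (u - x)) + 1 / 2 * (norm (u - z))\<^sup>2 - 1 / 2 * (norm (u - x))\<^sup>2"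
proof -
  have "GDERIV f x :> grad f x"
    using f assms unfolding curvature_class_def by blast
  then show ?thesis
    unfolding linearization_def grad_prox_smooth[OF \<open>GDERIV f x :> grad f x\<close>] prox_smooth_def
      norm_diff_squared_expand[of u z x]
    by (simp add: inner_add_left algebra_simps add_divide_distrib)
qed

section \<open>One subproblem with a fixed prox centre\<close>

context
  fixes z :: 'a
  assumes z: "z \<in> Z"
begin

interpretation sub: acg_problem "prox_smooth lam f z" h Z lam z mu L
  using h lam z mu L by unfold_locales auto

text \<open>Scaling by \<open>lam\<close> and adding the prox quadratic shifts the curvature range
  from \<open>-m\<close> and \<open>M\<close> to \<open>1 - lam * m\<close> and
  \<open>1 + lam * M\<close>.\<close>

lemma regular_at:
  assumes x: "x \<in> Omega"
  shows "sub.regular_at x"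
  unfolding sub.regular_at_def
proof
  fix u assume "u \<in> Z"
  then have u: "u \<in> Omega"
    using Omega by auto
  let ?n = "(norm (u - x))\<^sup>2" and ?l = "f x + grad f x \<bullet> (u - x)"
  have "lam * (?l - m / 2 * ?n) \<le> lam * f u" "lam * f u \<le> lam * (?l + M / 2 * ?n)"
    using curvature_class_lower[OF f u x] curvature_class_upper[OF f u x] lam by simp_all
  then show "linearization (prox_smooth lam f z) x u + mu / 2 * ?n \<le> prox_smooth lam f z u
    \<and> prox_smooth lam f z u \<le> linearization (prox_smooth lam f z) x u + L / 2 * ?n"
    unfolding linearization_prox_smooth[OF x] prox_smooth_def mu_def L_def
    by (simp add: algebra_simps add_divide_distrib diff_divide_distrib)
qed

lemma sub_\<psi>: "sub.\<psi> u = lam * \<phi> u + 1 / 2 * (norm (u - z))\<^sup>2"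
  unfolding sub.\<psi>_def \<phi>_def prox_smooth_def by (simp add: algebra_simps)

lemma strongly_convex_sub_\<psi>: "strongly_convex_on Z mu sub.\<psi>"
  unfolding strongly_convex_on_def
proof (intro ballI)
  fix x y and t :: real
  assume *: "x \<in> Z" "y \<in> Z" "t \<in> {0..1}"
  let ?v = "(1 - t) *\<^sub>R x + t *\<^sub>R y" and ?H = "\<lambda>u. real_of_ereal (h u)" and ?D = "(norm (x - y))\<^sup>2"
  have "lam * f ?v \<le> lam * ((1 - t) * f x + t * f y + m / 2 * (t * (1 - t)) * ?D)"
    using * Omega lam by (intro mult_left_mono curvature_class_convex_combination[OF f]) auto
  moreover have "lam * ?H ?v \<le> lam * ((1 - t) * ?H x + t * ?H y)"
    using * lam by (intro mult_left_mono Conv_bar_convex_combination(2)[OF h]) auto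
  moreover have "lam * (fv + hv) + 1 / 2 * ((1 - t) * X + t * Y - t * (1 - t) * D)
      \<le> (1 - t) * (lam * (fx + hx) + 1 / 2 * X) + t * (lam * (fy + hy) + 1 / 2 * Y)
        - mu / 2 * (t * (1 - t)) * D"
    if "lam * fv \<le> lam * ((1 - t) * fx + t * fy + m / 2 * (t * (1 - t)) * D)"
      "lam * hv \<le> lam * ((1 - t) * hx + t * hy)" for fv hv fx hx fy hy X Y D
    using that unfolding mu_def
    by (simp add: algebra_simps add_divide_distrib diff_divide_distrib power2_eq_square)
  ultimately show "sub.\<psi> ?v \<le> (1 - t) * sub.\<psi> x + t * sub.\<psi> y - mu / 2 * (t * (1 - t)) * ?D"
    unfolding sub_\<psi> \<phi>_def norm_convex_combination_squared by blast
qed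

lemma sub_acg1_eq: "sub_acg1 f h m M lam \<sigma> z = acg1_stops_at (prox_smooth lam f z) (scaled lam h) z mu L \<sigma>"
  unfolding sub_acg1_def mu_def L_def ..

lemma sub_output_eq: "sub_output f h m M lam z = sub.out"
  unfolding sub_output_def mu_def L_def ..

lemma sub_point_eq: "sub_point f h m M lam z k = acg_point mu L (sub.state k)"
  unfolding sub_point_def mu_def L_def ..

lemma sub_acg2_eq:
  "sub_acg2 f h m M lam \<rho> \<sigma> z = acg2_stops_at (prox_smooth lam f z) (scaled lam h) z mu L \<sigma>
     (lam * (\<rho>\<^sup>2 / (32 * (max m M + 1 / lam))))"
  unfolding sub_acg2_def mu_def L_def Let_def ..

text \<open>Expanding the prox quadratic around \<open>y\<close> moves its gradient into the
  subgradient, in the form that the refinement step expects.\<close>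

lemma sub_inequality:
  assumes "sub.regular_until k" "k \<ge> 1" "sub_output f h m M lam z k = (y, r, \<eta>)" "u \<in> Z"
  shows "lam * \<phi> y + (z - y + r) \<bullet> (u - y) - 1 / 2 * (norm (u - y))\<^sup>2 - \<eta> \<le> lam * \<phi> u"
  using sub.acg_output_properties(4)[OF assms(1,2) assms(3)[unfolded sub_output_eq] assms(4)]
  unfolding sub_\<psi> norm_diff_squared_expand[of u z y]
  by (simp add: inner_add_left inner_diff_left algebra_simps)

text \<open>The descent is the subgradient inequality at the centre \<open>z\<close>: after
  completing the square, the relative test absorbs the error. The constant \<open>9 / 16\<close> is
  \<open>1 / 2 * (1 + 1 / 8)\<close>, from \<open>A \<ge> 8\<close>.\<close>

lemma acg1_result:
  assumes "sub_acg1 f h m M lam \<sigma> z k1" "sub.regular_until k1" "sub_output f h m M lam z k1 = (y, r, \<eta>)"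
  shows "y \<in> Z"
    and "lam * \<phi> y + (1 - \<sigma>) / 2 * (norm (z - y + r))\<^sup>2 \<le> lam * \<phi> z"
    and "u \<in> Z \<Longrightarrow> lam * \<phi> y \<le> lam * \<phi> u + 9 / 16 * (norm (z - u))\<^sup>2"
    and "norm (z - y) \<le> 4 / 3 * norm (z - y + r)"
proof -
  note stop = sub.acg1_stops_atD[OF assms(1)[unfolded sub_acg1_eq]]
  note out = assms(3)[unfolded sub_output_eq]
  note props = sub.acg_output_properties[OF assms(2) stop(1) out]
  show "y \<in> Z"
    by (rule props)
  have "(norm r)\<^sup>2 + 2 * \<eta> \<le> \<sigma> * (norm (z - y + r))\<^sup>2"
    using stop(2) unfolding acg_relative_test_def out prod.case .
  moreover have "(norm (z - y + r))\<^sup>2 = (norm (z - y))\<^sup>2 + 2 * (r \<bullet> (z - y)) + (norm r)\<^sup>2"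
    unfolding power2_norm_eq_inner by (simp add: inner_add_left inner_add_right inner_commute)
  ultimately show "lam * \<phi> y + (1 - \<sigma>) / 2 * (norm (z - y + r))\<^sup>2 \<le> lam * \<phi> z"
    using props(4)[OF z] unfolding sub_\<psi> by (simp add: norm_minus_commute algebra_simps diff_divide_distrib)
  show "lam * \<phi> y \<le> lam * \<phi> u + 9 / 16 * (norm (z - u))\<^sup>2" if u: "u \<in> Z"
  proof -
    let ?A = "acg_A (prox_smooth lam f z) (scaled lam h) z mu L k1" and ?n = "1 / 2 * (norm (u - z))\<^sup>2"
    have "?A * sub.\<psi> y \<le> ?A * sub.\<psi> u + ?n"
      by (rule props(5)[OF u])
    then have "sub.\<psi> y \<le> sub.\<psi> u + ?n / ?A"
      using stop(3) by (simp add: field_simps)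
    also have "?n / ?A \<le> ?n / 8"
      using stop(3) by (intro divide_left_mono) auto
    finally have "lam * \<phi> y + 1 / 2 * (norm (y - z))\<^sup>2 \<le> lam * \<phi> u + ?n + ?n / 8"
      unfolding sub_\<psi> by simp
    moreover have "0 \<le> 1 / 2 * (norm (y - z))\<^sup>2"
      by simp
    ultimately have "lam * \<phi> y \<le> lam * \<phi> u + ?n + ?n / 8"
      by linarith
    then show ?thesis
      by (simp add: norm_minus_commute)
  qed
  show "norm (z - y) \<le> 4 / 3 * norm (z - y + r)"
    using sub.acg_residual_bounds(1)[OF assms(2) stop(1) out stop(3)] by simp
qed

context
  assumes centre: "aipp_centre f h m M lam \<rho> \<sigma> z0 z"
begin

text \<open>Since \<open>z\<close> is a centre that the method reaches, the queries made before
  stopping belong to \<open>aipp_queries\<close> and thus to \<open>Omega\<close>.\<close>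

lemma acg1_call:
  obtains k1 where "sub_acg1 f h m M lam \<sigma> z k1" "sub.regular_until k1" "k1 \<le> acg1_budget"
proof (rule sub.acg1_terminates[OF \<sigma>])
  fix k assume "\<And>j. j \<le> k \<Longrightarrow> \<not> acg1_stops_at (prox_smooth lam f z) (scaled lam h) z mu L \<sigma> j"
  then show "sub.regular_at (acg_point mu L (sub.state k))"
    using aipp_queries.acg1[OF centre, of k] queries
    unfolding sub_acg1_eq sub_point_eq by (intro regular_at) blast
qed (use that in \<open>simp add: sub_acg1_eq acg1_budget_def\<close>)

lemma acg2_call:
  assumes k1: "sub_acg1 f h m M lam \<sigma> z k1" "sub.regular_until k1" "k1 \<le> acg1_budget"
    and small: "residual_small f h m M lam \<rho> z k1"
  obtains k2 where "sub_acg2 f h m M lam \<rho> \<sigma> z k1 k2" "k2 \<le> acg2_budget"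
    "refine_point f h m M lam (fst (sub_output f h m M lam z k2)) \<in> Z"
    "refine_vector f h m M lam (fst (sub_output f h m M lam z k2)) \<in>
      (\<lambda>\<xi>. grad f (refine_point f h m M lam (fst (sub_output f h m M lam z k2))) + \<xi>) `
        subdifferential h (refine_point f h m M lam (fst (sub_output f h m M lam z k2)))"
    "norm (refine_vector f h m M lam (fst (sub_output f h m M lam z k2))) \<le> \<rho>"
proof -
  define \<eta>bar where "\<eta>bar = lam * (\<rho>\<^sup>2 / (32 * (max m M + 1 / lam)))"
  obtain y1 r1 \<eta>1 where out1: "sub_output f h m M lam z k1 = (y1, r1, \<eta>1)"
    by (cases "sub_output f h m M lam z k1") auto
  note stop1 = sub.acg1_stops_atD[OF k1(1)[unfolded sub_acg1_eq]]
  have "norm (z - y1 + r1) \<le> lam * \<rho> / 20"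
    using small unfolding residual_small_def out1 by simp
  then have D1: "norm (z - y1) \<le> lam * \<rho> / 15"
    using acg1_result(4)[OF k1(1,2) out1] by simp
  \<comment> \<open>The target weight \<open>L\<close> suffices: \<open>lam * m < 1\<close> gives
    \<open>lam * K \<le> 2 * L\<close>, and the claim amounts to
    \<open>64 * (lam * K) \<le> 225 * L\<close>. The 15 is 20 times \<open>3 / 4\<close>.\<close>
  have \<eta>bar: "2 * (lam * \<rho> / 15)\<^sup>2 \<le> L * \<eta>bar"
  proof -
    define K where "K = max m M + 1 / lam"
    have K: "K > 0"
      using m lam by (simp add: K_def add_pos_pos max_def)
    have "lam * K = max (lam * m) (lam * M) + 1"
      unfolding K_def using lam by (auto simp: max_def algebra_simps)
    then have "lam * K \<le> 2 * L"
      using mu(1) mult_pos_pos[OF lam(1) M] unfolding mu_def L_def by (auto simp: max_def mult.commute)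
    then have "(lam * K) * (64 * (lam * \<rho>\<^sup>2)) \<le> (2 * L) * (64 * (lam * \<rho>\<^sup>2))"
      using lam by (intro mult_right_mono) auto
    moreover have "0 \<le> L * (lam * \<rho>\<^sup>2)"
      using lam L by simp
    ultimately have "(lam * K) * (64 * (lam * \<rho>\<^sup>2)) \<le> 225 * (L * (lam * \<rho>\<^sup>2))"
      by linarith
    then show ?thesis
      unfolding \<eta>bar_def K_def[symmetric] using K by (simp add: field_simps power2_eq_square)
  qed
  obtain k2 where k2: "sub_acg2 f h m M lam \<rho> \<sigma> z k1 k2" "sub.regular_until k2" "k2 \<le> acg2_budget"
  proof (rule sub.acg2_terminates[OF \<sigma> _ strongly_convex_sub_\<psi> k1(1)[unfolded sub_acg1_eq] k1(2)
        k1(3)[unfolded acg1_budget_def] out1[unfolded sub_output_eq] D1 \<eta>bar])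
    show "mu \<le> L" "0 < L"
      using mu L by auto
    fix k assume *: "\<And>j. j \<le> k \<Longrightarrow>
      \<not> acg2_stops_at (prox_smooth lam f z) (scaled lam h) z mu L \<sigma> \<eta>bar k1 j"
    then show "sub.regular_at (acg_point mu L (sub.state k))"
      using aipp_queries.acg2[OF centre k1(1) small, of k] queries
      unfolding sub_acg2_eq sub_point_eq \<eta>bar_def by (intro regular_at) blast
  qed (use that in \<open>simp add: sub_acg2_eq acg1_budget_def acg2_budget_def \<eta>bar_def\<close>)
  obtain y2 r2 \<eta>2 where out2: "sub_output f h m M lam z k2 = (y2, r2, \<eta>2)"
    by (cases "sub_output f h m M lam z k2") auto
  have "k1 \<le> k2" "\<eta>2 \<le> \<eta>bar"
    using k2(1) out2 unfolding sub_acg2_eq acg2_stops_at_def first_from_def sub_output_eq \<eta>bar_def by auto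
  have "k2 \<ge> 1"
    using \<open>k1 \<le> k2\<close> stop1(1) by simp
  have mono: "acg_A (prox_smooth lam f z) (scaled lam h) z mu L k1 \<le> acg_A (prox_smooth lam f z) (scaled lam h) z mu L k2"
    using mu L \<open>k1 \<le> k2\<close> by (intro acg_A_mono) auto
  \<comment> \<open>The small residual was tested at the ACG1 output only. Passing to the ACG2
    output costs a factor 2, and returning to the residual a factor \<open>5 / 4\<close>, so
    \<open>lam * \<rho> / 15\<close> becomes \<open>lam * \<rho> / 6\<close>.\<close>
  have "norm (z - y2) \<le> 2 * norm (z - y1)"
    using mono stop1(4)
    by (intro sub.acg_outputs_comparable[OF strongly_convex_sub_\<psi> k1(2) stop1(1) out1[unfolded sub_output_eq] stop1(4)
        k2(2) \<open>k2 \<ge> 1\<close> out2[unfolded sub_output_eq]]) simp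
  moreover have "norm (z - y2 + r2) \<le> 5 / 4 * norm (z - y2)"
    using mono stop1(3)
    by (intro sub.acg_residual_bounds(2)[OF k2(2) \<open>k2 \<ge> 1\<close> out2[unfolded sub_output_eq]]) simp
  ultimately have "norm (z - y2 + r2) \<le> lam * \<rho> / 6"
    using D1 by simp
  then have w: "norm (z - y2 + r2) \<le> lam * \<rho> / 4"
    using mult_pos_pos[OF lam(1) \<rho>] by linarith
  have y2: "y2 \<in> Z"
    by (rule sub.acg_output_properties(1)[OF k2(2) \<open>k2 \<ge> 1\<close> out2[unfolded sub_output_eq]])
  note refine = refine_point_properties[OF h f Omega m M lam(1) \<rho> y2
      sub_inequality[OF k2(2) \<open>k2 \<ge> 1\<close> out2, unfolded \<phi>_def] w \<open>\<eta>2 \<le> \<eta>bar\<close>[unfolded \<eta>bar_def]]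
  have "fst (sub_output f h m M lam z k2) = y2"
    by (simp add: out2)
  then show thesis
    using that k2 refine by metis
qed

end

end

section \<open>Outer iterations\<close>

definition solves :: "'a \<Rightarrow> 'a \<Rightarrow> bool" where
  "solves zhat vhat \<longleftrightarrow> zhat \<in> Z \<and> vhat \<in> (\<lambda>\<xi>. grad f zhat + \<xi>) ` subdifferential h zhat \<and> norm vhat \<le> \<rho>"

text \<open>A failed residual test means a residual above \<open>lam * \<rho> / 20\<close>, and half
  of \<open>1 / 20\<^sup>2\<close> is \<open>1 / 800\<close>. The last clause of the second case
  prepends this call to a run that starts at \<open>y\<close>.\<close>

lemma aipp_outer_step:
  assumes z: "z \<in> Z" and centre: "aipp_centre f h m M lam \<rho> \<sigma> z0 z"
  obtains (stop) N zhat vhat where "aipp f h m M lam \<rho> \<sigma> z N zhat vhat" "solves zhat vhat" "N \<le> acg1_budget + acg2_budget"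
  | (step) k1 y where "aipp_centre f h m M lam \<rho> \<sigma> z0 y" "y \<in> Z" "k1 \<le> acg1_budget"
      "lam * \<phi> y + (1 - \<sigma>) * lam\<^sup>2 * \<rho>\<^sup>2 / 800 \<le> lam * \<phi> z"
      "\<And>u. u \<in> Z \<Longrightarrow> lam * \<phi> y \<le> lam * \<phi> u + 9 / 16 * (norm (z - u))\<^sup>2"
      "\<And>N zhat vhat. aipp f h m M lam \<rho> \<sigma> y N zhat vhat \<Longrightarrow> aipp f h m M lam \<rho> \<sigma> z (k1 + N) zhat vhat"
proof (rule acg1_call[OF z centre])
  fix k1 assume k1: "sub_acg1 f h m M lam \<sigma> z k1"
    "acg_problem.regular_until (prox_smooth lam f z) h Z lam z mu L k1" "k1 \<le> acg1_budget"
  obtain y r \<eta> where out: "sub_output f h m M lam z k1 = (y, r, \<eta>)"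
    by (cases "sub_output f h m M lam z k1") auto
  show thesis
  proof (cases "residual_small f h m M lam \<rho> z k1")
    case True
    obtain k2 where k2: "sub_acg2 f h m M lam \<rho> \<sigma> z k1 k2" "k2 \<le> acg2_budget"
      and solves: "solves (refine_point f h m M lam (fst (sub_output f h m M lam z k2)))
        (refine_vector f h m M lam (fst (sub_output f h m M lam z k2)))"
      by (rule acg2_call[OF z centre k1 True], rule that, assumption, assumption,
        unfold solves_def, intro conjI, assumption+)
    show thesis
      by (rule stop[OF aipp.final[OF k1(1) True k2(1) refl] solves]) (use k1(3) k2(2) in simp)
  next
    case False
    note result = acg1_result[OF z k1(1,2) out]
    have y: "y = fst (sub_output f h m M lam z k1)"
      by (simp add: out)
    have "lam * \<rho> / 20 \<le> norm (z - y + r)"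
      using False unfolding residual_small_def out by simp
    then have "(lam * \<rho> / 20)\<^sup>2 \<le> (norm (z - y + r))\<^sup>2"
      using lam \<rho> by (intro power_mono) auto
    then have "(1 - \<sigma>) / 2 * (lam * \<rho> / 20)\<^sup>2 \<le> (1 - \<sigma>) / 2 * (norm (z - y + r))\<^sup>2"
      using \<sigma> by (intro mult_left_mono) auto
    moreover have "(1 - \<sigma>) / 2 * (lam * \<rho> / 20)\<^sup>2 = (1 - \<sigma>) * lam\<^sup>2 * \<rho>\<^sup>2 / 800"
      by (simp add: power_divide power_mult_distrib)
    ultimately have "lam * \<phi> y + (1 - \<sigma>) * lam\<^sup>2 * \<rho>\<^sup>2 / 800 \<le> lam * \<phi> z"
      using result(2) by linarith
    moreover have "aipp_centre f h m M lam \<rho> \<sigma> z0 y"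
      unfolding y by (rule aipp_centre.next[OF centre k1(1) False])
    ultimately show thesis
      using step[of y k1] result(1,3) k1(3) aipp.outer[OF k1(1) False, folded y] by blast
  qed
qed

text \<open>The gap cannot pay for \<open>n\<close> decreases. Each unsuccessful outer iteration
  uses up one of them, and \<open>n = 0\<close> contradicts the nonnegative gap.\<close>

lemma aipp_terminates_from:
  assumes "z \<in> Z" "aipp_centre f h m M lam \<rho> \<sigma> z0 z"
    and "lam * (\<phi> z - \<phi>_inf) < real n * ((1 - \<sigma>) * lam\<^sup>2 * \<rho>\<^sup>2 / 800)"
  shows "\<exists>N zhat vhat. aipp f h m M lam \<rho> \<sigma> z N zhat vhat \<and> solves zhat vhat \<and> N \<le> n * acg1_budget + acg2_budget"
  using assms
proof (induction n arbitrary: z)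
  case 0
  have "0 \<le> lam * (\<phi> z - \<phi>_inf)"
    using lam \<phi>_inf_le[OF 0(1)] by simp
  with 0 show ?case
    by simp
next
  case (Suc n)
  from Suc.prems(1,2) show ?case
  proof (cases rule: aipp_outer_step)
    case (stop N zhat vhat)
    then show ?thesis
      by (intro exI[of _ N] exI[of _ zhat] exI[of _ vhat]) auto
  next
    case (step k1 y)
    have "lam * (\<phi> y - \<phi>_inf) < real n * ((1 - \<sigma>) * lam\<^sup>2 * \<rho>\<^sup>2 / 800)"
    proof -
      define \<delta> where "\<delta> = (1 - \<sigma>) * lam\<^sup>2 * \<rho>\<^sup>2 / 800"
      show ?thesis
        using step(4) Suc.prems(3) unfolding \<delta>_def[symmetric] by (simp add: algebra_simps)
    qed
    from Suc.IH[OF step(2,1) this] obtain N zhat vhat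
      where N: "aipp f h m M lam \<rho> \<sigma> y N zhat vhat" "solves zhat vhat" "N \<le> n * acg1_budget + acg2_budget"
      by blast
    then show ?thesis
      using step(6)[OF N(1)] step(3) by (intro exI[of _ "k1 + N"] exI[of _ zhat] exI[of _ vhat]) auto
  qed
qed

lemma prox_gap_lower:
  assumes "\<And>u. u \<in> Z \<Longrightarrow> c \<le> 1 / 2 * (norm (z0 - u))\<^sup>2 + lam * (\<phi> u - \<phi>_inf)"
  shows "ereal c \<le> prox_gap lam (composite f h) z0"
  unfolding prox_gap_def INF_composite
proof (rule INF_greatest)
  fix u
  show "ereal c \<le> ereal (1 / 2 * (norm (z0 - u))\<^sup>2) + ereal lam * (composite f h u - ereal \<phi>_inf)"
  proof (cases "u \<in> Z")
    case True
    then show ?thesis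
      using assms[OF True] by (simp add: composite_eq)
  next
    case False
    then show ?thesis
      using lam by (simp add: composite_outside)
  qed
qed

text \<open>Finiteness comes from the candidate \<open>u = z0\<close> in the infimum.\<close>

lemma prox_gap_real:
  obtains R where "prox_gap lam (composite f h) z0 = ereal R" "R \<ge> 0"
proof -
  have "ereal 0 \<le> prox_gap lam (composite f h) z0"
    using lam \<phi>_inf_le by (intro prox_gap_lower) simp
  moreover have "prox_gap lam (composite f h) z0 \<le> ereal (lam * (\<phi> z0 - \<phi>_inf))"
    unfolding prox_gap_def INF_composite by (rule INF_lower2[of z0]) (auto simp: composite_eq[OF z0])
  ultimately show thesis
    using that by (cases "prox_gap lam (composite f h) z0") auto
qed

end

section \<open>From iteration budgets to the stated bound\<close>

context aipp_problem
begin

definition rate_factor :: real where "rate_factor = sqrt (L / min \<sigma> mu)"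

lemma rate_factor_ge: "1 \<le> rate_factor" "sqrt (L / mu) \<le> rate_factor"
proof -
  have "1 \<le> L / min \<sigma> mu"
    using \<sigma> mu L by simp
  then show "1 \<le> rate_factor"
    unfolding rate_factor_def by (simp del: le_divide_eq_1_pos)
  show "sqrt (L / mu) \<le> rate_factor"
    unfolding rate_factor_def using \<sigma> mu L by (intro real_sqrt_le_mono divide_left_mono mult_pos_pos) auto
qed

lemma acg1_budget_le: "real acg1_budget \<le> 7 * rate_factor"
proof -
  have "real acg1_budget \<le> 6 * rate_factor + 1"
    unfolding acg1_budget_def rate_factor_def[symmetric] using rate_factor_ge(1) by linarith
  then show ?thesis
    using rate_factor_ge(1) by linarith
qed

lemma log1_plus_ge: "1 \<le> log1_plus t"
  unfolding log1_plus_def by simp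

text \<open>For \<open>lam * M \<le> 1\<close> the logarithm is at most 1; otherwise
  \<open>L \<le> 2 * (lam * M)\<close> and \<open>ln 2 < 1\<close>.\<close>

lemma ln_L_le: "ln L \<le> 2 * log1_plus (lam * M)"
proof (cases "lam * M \<le> 1")
  case True
  have "ln L \<le> L - 1"
    using L by (intro ln_le_minus_one) simp
  also have "\<dots> \<le> 1"
    using True by (simp add: L_def)
  finally show ?thesis
    using log1_plus_ge[of "lam * M"] by linarith
next
  case False
  then have "ln L \<le> ln (2 * (lam * M))"
    using L by (subst ln_le_cancel_iff) (auto simp: L_def mult.commute)
  also have "\<dots> = ln 2 + ln (lam * M)"
    using False by (intro ln_mult_pos) auto
  also have "\<dots> \<le> log1_plus (lam * M) + log1_plus (lam * M)"
    using ln_2_less_1 unfolding log1_plus_def by (intro add_mono) auto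
  finally show ?thesis
    by simp
qed

text \<open>The 17 is made of 7 for the ACG1 part, 8 for the logarithm, and 1 each for the successor
  and the rounding.\<close>

lemma acg2_budget_le: "real acg2_budget \<le> 17 * rate_factor * log1_plus (lam * M)"
proof -
  let ?l = "log1_plus (lam * M)"
  have L0: "0 \<le> ln L"
    using L by simp
  have "2 * sqrt (L / mu) * ln (L * L) = sqrt (L / mu) * (4 * ln L)"
    using L by (simp add: ln_mult)
  also have "\<dots> \<le> rate_factor * (4 * (2 * ?l))"
    using rate_factor_ge L0 ln_L_le by (intro mult_mono) auto
  finally have "2 * sqrt (L / mu) * ln (L * L) \<le> 8 * (rate_factor * ?l)"
    by simp
  moreover have "rate_factor \<le> rate_factor * ?l"
    using mult_left_mono[OF log1_plus_ge[of "lam * M"], of rate_factor] rate_factor_ge(1) by simp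
  ultimately have "real (nat \<lceil>2 * sqrt (L / mu) * ln (L * L)\<rceil>) \<le> 8 * (rate_factor * ?l) + 1"
    using rate_factor_ge(1) by linarith
  moreover have "real acg2_budget = real acg1_budget + 1 + real (nat \<lceil>2 * sqrt (L / mu) * ln (L * L)\<rceil>)"
    unfolding acg2_budget_def by simp
  ultimately show ?thesis
    using acg1_budget_le rate_factor_ge(1) \<open>rate_factor \<le> rate_factor * ?l\<close> unfolding mult.assoc by linarith
qed

text \<open>The first outer iteration is split off, since the gap at \<open>z0\<close> itself is not
  controlled by the prox gap. It accounts for one of the two extra ACG1 budgets; rounding the number
  of later decreases accounts for the other.\<close>

lemma aipp_complexity:
  "\<exists>N zhat vhat. aipp f h m M lam \<rho> \<sigma> z0 N zhat vhat \<and> solves zhat vhat \<and>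
    bigO_count N
      (ereal (sqrt ((lam * M + 1) / min \<sigma> (1 - lam * m))) *
        (prox_gap lam (composite f h) z0 / ereal ((1 - \<sigma>)\<^sup>2 * lam\<^sup>2 * \<rho>\<^sup>2) + ereal (log1_plus (lam * M))))"
proof -
  obtain R where R: "prox_gap lam (composite f h) z0 = ereal R" "R \<ge> 0"
    by (rule prox_gap_real)
  define \<delta> where "\<delta> = (1 - \<sigma>) * lam\<^sup>2 * \<rho>\<^sup>2 / 800"
  have \<delta>: "\<delta> > 0"
    unfolding \<delta>_def using \<sigma> lam \<rho> by simp
  define X where "X = (1 - \<sigma>)\<^sup>2 * lam\<^sup>2 * \<rho>\<^sup>2"
  have X: "X > 0"
    unfolding X_def using \<sigma> lam \<rho> by simp
  \<comment> \<open>The guaranteed decrease carries one factor \<open>1 - \<sigma>\<close> and the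
    claimed rate carries two; the second is at most 1.\<close>
  have "X \<le> 800 * \<delta>"
  proof -
    have "(1 - \<sigma>) * (1 - \<sigma>) \<le> (1 - \<sigma>) * 1"
      using \<sigma> by (intro mult_left_mono) auto
    then have "(1 - \<sigma>)\<^sup>2 * (lam\<^sup>2 * \<rho>\<^sup>2) \<le> (1 - \<sigma>) * (lam\<^sup>2 * \<rho>\<^sup>2)"
      by (intro mult_right_mono) (auto simp: power2_eq_square)
    then show ?thesis
      unfolding X_def \<delta>_def by (simp add: mult.assoc)
  qed
  then have "R / (800 * \<delta>) \<le> R / X"
    using R(2) X by (intro divide_left_mono mult_pos_pos) auto
  then have R\<delta>: "R / \<delta> \<le> 800 * (R / X)"
    by simp
  have "R / X \<ge> 0"
    using R X by simp
  obtain N zhat vhat where N: "aipp f h m M lam \<rho> \<sigma> z0 N zhat vhat" "solves zhat vhat"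
    and N_le: "real N \<le> (2 + 9 / 8 * (R / \<delta>)) * real acg1_budget + real acg2_budget"
  proof (rule aipp_outer_step[OF z0 aipp_centre.init], goal_cases)
    case (1 N zhat vhat)
    have "real N \<le> real acg1_budget + real acg2_budget"
      using 1(4) by linarith
    also have "real acg1_budget \<le> (2 + 9 / 8 * (R / \<delta>)) * real acg1_budget"
      using R(2) \<delta> mult_right_mono[of 1 "2 + 9 / 8 * (R / \<delta>)" "real acg1_budget"] by simp
    finally show thesis
      using 1(1)[OF 1(2,3)] by simp
  next
    case (2 k1 y)
    note y = 2(2-)
    have "ereal (8 / 9 * (lam * (\<phi> y - \<phi>_inf))) \<le> prox_gap lam (composite f h) z0"
    proof (rule prox_gap_lower)
      fix u assume u: "u \<in> Z"
      have "0 \<le> lam * (\<phi> u - \<phi>_inf)"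
        using lam \<phi>_inf_le[OF u] by simp
      moreover have "lam * (\<phi> y - \<phi>_inf) \<le> lam * (\<phi> u - \<phi>_inf) + 9 / 16 * (norm (z0 - u))\<^sup>2"
        using y(5)[OF u] by (simp add: right_diff_distrib)
      \<comment> \<open>The factor \<open>8 / 9\<close> scales \<open>9 / 16\<close> to the
        \<open>1 / 2\<close> of the prox gap; on the nonnegative gap term it only helps.\<close>
      ultimately show "8 / 9 * (lam * (\<phi> y - \<phi>_inf)) \<le> 1 / 2 * (norm (z0 - u))\<^sup>2 + lam * (\<phi> u - \<phi>_inf)"
        by linarith
    qed
    then have gap: "lam * (\<phi> y - \<phi>_inf) \<le> 9 / 8 * R"
      unfolding R(1) by simp
    \<comment> \<open>Floor plus one gives the strict inequality that the induction on decreases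
      requires.\<close>
    define n where "n = nat \<lfloor>9 / 8 * R / \<delta>\<rfloor> + 1"
    have n: "9 / 8 * R / \<delta> < real n" "real n \<le> 9 / 8 * R / \<delta> + 1"
      unfolding n_def using R(2) \<delta> by (auto simp: floor_le_iff) linarith+
    have "9 / 8 * R < real n * \<delta>"
      using n(1) \<delta> by (simp add: pos_divide_less_eq)
    then have "lam * (\<phi> y - \<phi>_inf) < real n * \<delta>"
      using gap by linarith
    then obtain N zhat vhat where N: "aipp f h m M lam \<rho> \<sigma> y N zhat vhat" "solves zhat vhat" "N \<le> n * acg1_budget + acg2_budget"
      using aipp_terminates_from[OF y(2,1), of n] unfolding \<delta>_def by blast
    have "real (k1 + N) \<le> real acg1_budget + (real n * real acg1_budget + real acg2_budget)"
      using N(3) y(3) by (metis of_nat_add of_nat_mult of_nat_mono add_mono)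
    also have "\<dots> \<le> real acg1_budget + ((9 / 8 * R / \<delta> + 1) * real acg1_budget + real acg2_budget)"
      using n(2) by (intro add_mono mult_right_mono) auto
    also have "\<dots> = (2 + 9 / 8 * (R / \<delta>)) * real acg1_budget + real acg2_budget"
      by (simp add: algebra_simps)
    finally show thesis
      using 2(1)[OF y(6)[OF N(1)] N(2)] by simp
  qed
  let ?l = "log1_plus (lam * M)"
  \<comment> \<open>Here 900 is \<open>9 / 8 * 800\<close>.\<close>
  have "real N \<le> (2 + 900 * (R / X)) * (7 * rate_factor) + 17 * rate_factor * ?l"
  proof -
    have "(2 + 9 / 8 * (R / \<delta>)) * real acg1_budget \<le> (2 + 900 * (R / X)) * (7 * rate_factor)"
      using R\<delta> acg1_budget_le rate_factor_ge(1) \<open>R / X \<ge> 0\<close> by (intro mult_mono) auto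
    then show ?thesis
      using N_le acg2_budget_le by linarith
  qed
  also have "\<dots> = 6300 * (rate_factor * (R / X)) + 14 * rate_factor + 17 * (rate_factor * ?l)"
    by (simp add: algebra_simps)
  also have "\<dots> \<le> 1000000 * (rate_factor * (R / X + ?l))"
  proof -
    have "rate_factor \<le> rate_factor * ?l"
      using mult_left_mono[OF log1_plus_ge[of "lam * M"], of rate_factor] rate_factor_ge(1) by simp
    moreover have "0 \<le> rate_factor * (R / X)"
      using rate_factor_ge(1) \<open>R / X \<ge> 0\<close> by (intro mult_nonneg_nonneg) auto
    moreover have "6300 * p + 14 * s + 17 * q \<le> 1000000 * (p + q)" if "s \<le> q" "0 \<le> p" "1 \<le> s" for p q s :: real
      using that by simp
    ultimately show ?thesis
      using rate_factor_ge(1) unfolding distrib_left[of rate_factor] by blast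
  qed
  also have "\<dots> \<le> 1000000 * max 1 (rate_factor * (R / X + ?l))"
    by simp
  finally have "bigO_count N (ereal (rate_factor * (R / X + ?l)))"
    unfolding bigO_count_def bigO_const_def by (simp add: max_def split: if_splits)
  moreover have "ereal rate_factor * (ereal R / ereal X + ereal ?l) = ereal (rate_factor * (R / X + ?l))"
    using X by simp
  moreover have "rate_factor = sqrt ((lam * M + 1) / min \<sigma> (1 - lam * m))"
    unfolding rate_factor_def L_def mu_def by (simp add: add.commute)
  ultimately show ?thesis
    using N unfolding R(1) X_def by metis
qed

end

theorem theorem3p3p5:
  fixes Z Omega :: "'a::euclidean_space set"
    and f :: "'a \<Rightarrow> real" and h :: "'a \<Rightarrow> ereal"
    and m M \<rho> \<sigma> lam :: real and z0 :: 'a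
  assumes "Z \<noteq> {}" and "convex Z" and "h \<in> Conv_bar Z"
    and "m > 0" and "M > 0"
    and "Z \<subseteq> Omega" and "convex Omega" and "interior Omega \<noteq> {}"
    and "f \<in> curvature_class m M Omega"
    and "aipp_queries f h m M lam \<rho> \<sigma> z0 \<subseteq> Omega"
    and "(INF z. composite f h z) > -\<infinity>"
    and "\<rho> > 0" and "0 < \<sigma>" and "\<sigma> < 1" and "0 < lam" and "lam < 1 / m" and "z0 \<in> Z"
  shows "\<exists>N zhat vhat.
    aipp f h m M lam \<rho> \<sigma> z0 N zhat vhat \<and>
    zhat \<in> Z \<and>
    vhat \<in> (\<lambda>\<xi>. grad f zhat + \<xi>) ` subdifferential h zhat \<and>
    norm vhat \<le> \<rho> \<and>
    bigO_count N
      (ereal (sqrt ((lam * M + 1) / min \<sigma> (1 - lam * m))) *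
        (prox_gap lam (composite f h) z0 / ereal ((1 - \<sigma>)\<^sup>2 * lam\<^sup>2 * \<rho>\<^sup>2) + ereal (log1_plus (lam * M))))"
proof -
  interpret aipp_problem Z Omega f h m M \<rho> \<sigma> lam z0
    using assms by unfold_locales
  show ?thesis
    using aipp_complexity unfolding solves_def by blast
qed

end
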